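(* There exists a universal constant $C$ such that for every pointed doubling metric space $(M,d)$ with doubling constant $D(M)$, the Lipschitz-free space $\mathcal{F}(M)$ has the $C(1+\log(D(M)))$-bounded approximation property.
   Context: A metric space $(M,d)$ is called doubling if there exists a constant $D(M)>0$ such that any open ball $B(p,R)$ in $M$ can be covered with at most $D(M)$ open balls of radius $R/2$; $D(M)$ denotes such a constant. A pointed metric space is a metric space $(M,d)$ with a distinguished element denoted $0$. $\mathrm{Lip}_0(M)$ is the Banach space of all real-valued Lipschitz functions $f$ on $M$ with $f(0)=0$, with norm the Lipschitz constant $\mathrm{Lip}(f)=\sup\{|f(x)-f(y)|/d(x,y):\ x\ne y\in M\}$. For $p\in M$, $\delta(p)\in \mathrm{Lip}_0(M)^*$ is the evaluation $\langle g,\delta(p)\rangle=g(p)$. The Lipschitz-free space $\mathcal{F}(M)$ is the norm-closed linear span of $\{\delta(p):p\in M\}$ in $\mathrm{Lip}_0(M)^*$. For $1\le\lambda<\infty$, a Banach space $Z$ has the $\lambda$-bounded approximation property if for every $\varepsilon>0$ and every compact set $L\subset Z$ there is a bounded finite-rank linear operator $T:Z\to Z$ with $\|T\|\le\lambda$ and $\|T(x)-x\|\le\varepsilon$ for all $x\in L$. *)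

theory Defs
  imports "HOL-Analysis.Analysis" "HOL-Library.Function_Algebras"
begin

text \<open>Real-valued functions and functionals form real vector spaces under the pointwise operations.\<close>

instantiation "fun" :: (type, real_vector) real_vector
begin

definition scaleR_fun :: "real \<Rightarrow> ('a \<Rightarrow> 'b) \<Rightarrow> 'a \<Rightarrow> 'b"
  where "scaleR_fun c f = (\<lambda>x. c *\<^sub>R f x)"

instance
  by standard (auto simp: scaleR_fun_def fun_eq_iff scaleR_add_right scaleR_add_left)

end

lemma scaleR_fun_apply [simp]: "(c *\<^sub>R f) x = c *\<^sub>R f x"
  by (simp add: scaleR_fun_def)

text \<open>The Banach spaces below depend on a term (a metric space), so they cannot be types; normed
  spaces are given by a carrier \<^term>\<open>Z\<close>, a subspace of a real vector space, and a norm \<^term>\<open>nrm\<close>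
  which is meaningful on \<^term>\<open>Z\<close> only. The distance is set to \<open>0\<close> outside \<^term>\<open>Z\<close> because the
  locale \<^locale>\<open>Metric_space\<close> requires symmetry and nonnegativity on the whole type.\<close>

definition norm_dist :: "'v::real_vector set \<Rightarrow> ('v \<Rightarrow> real) \<Rightarrow> 'v \<Rightarrow> 'v \<Rightarrow> real"
  where "norm_dist Z nrm x y = (if x \<in> Z \<and> y \<in> Z then nrm (x - y) else 0)"

definition norm_topology :: "'v::real_vector set \<Rightarrow> ('v \<Rightarrow> real) \<Rightarrow> 'v topology"
  where "norm_topology Z nrm = Metric_space.mtopology Z (norm_dist Z nrm)"

definition finite_rank_operator :: "'v::real_vector set \<Rightarrow> ('v \<Rightarrow> 'v) \<Rightarrow> bool"
  where "finite_rank_operator Z T \<longleftrightarrow>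
    T \<in> Z \<rightarrow> Z \<and>
    (\<forall>x\<in>Z. \<forall>y\<in>Z. T (x + y) = T x + T y) \<and>
    (\<forall>c. \<forall>x\<in>Z. T (c *\<^sub>R x) = c *\<^sub>R T x) \<and>
    (\<exists>B. finite B \<and> T ` Z \<subseteq> span B)"

text \<open>The conjunct \<open>nrm (T x) \<le> K * nrm x\<close> says both that \<^term>\<open>T\<close> is bounded and that its operator
  norm is at most \<open>K\<close>.\<close>

definition bounded_approximation_property ::
    "real \<Rightarrow> 'v::real_vector set \<Rightarrow> ('v \<Rightarrow> real) \<Rightarrow> bool"
  where "bounded_approximation_property K Z nrm \<longleftrightarrow>
    1 \<le> K \<and>
    (\<forall>\<epsilon>>0. \<forall>L. compactin (norm_topology Z nrm) L \<longrightarrow>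
      (\<exists>T. finite_rank_operator Z T \<and>
        (\<forall>x\<in>Z. nrm (T x) \<le> K * nrm x) \<and>
        (\<forall>x\<in>L. nrm (T x - x) \<le> \<epsilon>)))"

definition doubling_constant :: "'a metric \<Rightarrow> real \<Rightarrow> bool"
  where "doubling_constant M D \<longleftrightarrow>
    0 < D \<and>
    (\<forall>p\<in>mspace M. \<forall>R>0. \<exists>P. finite P \<and> P \<subseteq> mspace M \<and> real (card P) \<le> D \<and>
      mball_of M p R \<subseteq> (\<Union>q\<in>P. mball_of M q (R / 2)))"

text \<open>A function on \<^term>\<open>mspace M\<close> is represented by its extension by \<open>0\<close> to the whole type, so that
  equality of functions on \<^term>\<open>mspace M\<close> is equality in HOL.\<close>

definition Lip0 :: "'a metric \<Rightarrow> 'a \<Rightarrow> ('a \<Rightarrow> real) set"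
  where "Lip0 M z = {f. Lipschitz_continuous_map M euclidean_metric f \<and> f z = 0 \<and>
    (\<forall>x. x \<notin> mspace M \<longrightarrow> f x = 0)}"

text \<open>The element \<open>0\<close> is inserted because \<^term>\<open>Sup {} :: real\<close> is unspecified; it matters
  only if \<^term>\<open>mspace M\<close> is a singleton.\<close>

definition Lip_norm :: "'a metric \<Rightarrow> ('a \<Rightarrow> real) \<Rightarrow> real"
  where "Lip_norm M f =
    Sup (insert 0 {\<bar>f x - f y\<bar> / mdist M x y | x y. x \<in> mspace M \<and> y \<in> mspace M \<and> x \<noteq> y})"

text \<open>As above, a functional on \<^term>\<open>Lip0 M z\<close> is extended by \<open>0\<close> to functions outside
  \<^term>\<open>Lip0 M z\<close>.\<close>

definition Lip0_dual :: "'a metric \<Rightarrow> 'a \<Rightarrow> (('a \<Rightarrow> real) \<Rightarrow> real) set"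
  where "Lip0_dual M z = {\<phi>.
    (\<forall>f\<in>Lip0 M z. \<forall>g\<in>Lip0 M z. \<phi> (f + g) = \<phi> f + \<phi> g) \<and>
    (\<forall>c. \<forall>f\<in>Lip0 M z. \<phi> (c *\<^sub>R f) = c * \<phi> f) \<and>
    (\<exists>B. \<forall>f\<in>Lip0 M z. \<bar>\<phi> f\<bar> \<le> B * Lip_norm M f) \<and>
    (\<forall>f. f \<notin> Lip0 M z \<longrightarrow> \<phi> f = 0)}"

definition dual_norm :: "'a metric \<Rightarrow> 'a \<Rightarrow> (('a \<Rightarrow> real) \<Rightarrow> real) \<Rightarrow> real"
  where "dual_norm M z \<phi> = Sup {\<bar>\<phi> f\<bar> | f. f \<in> Lip0 M z \<and> Lip_norm M f \<le> 1}"

definition evaluation :: "'a metric \<Rightarrow> 'a \<Rightarrow> 'a \<Rightarrow> ('a \<Rightarrow> real) \<Rightarrow> real"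
  where "evaluation M z p = (\<lambda>g. if g \<in> Lip0 M z then g p else 0)"

definition Lipschitz_free :: "'a metric \<Rightarrow> 'a \<Rightarrow> (('a \<Rightarrow> real) \<Rightarrow> real) set"
  where "Lipschitz_free M z =
    norm_topology (Lip0_dual M z) (dual_norm M z) closure_of span (evaluation M z ` mspace M)"

text \<open>HOL cannot quantify over types inside a formula, so in \<open>\<exists>C. \<forall>M :: 'a metric. \<dots>\<close> the constant
  \<open>C\<close> could depend on \<open>'a\<close>. A closed constant of type \<^typ>\<open>real\<close> whose definition involves no type
  variable cannot: any statement about it that holds for all \<open>M :: 'a metric\<close>, with \<open>'a\<close> arbitrary,
  exhibits one constant for all metric spaces over all types. Which number is named is
  irrelevant for this; the definition picks one that works for the metric spaces
  whose points are real numbers (with arbitrary metrics), if there is any. Doubling spaces are separable,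
  hence have at most continuum many points and are isometric to such a space.\<close>

definition universal_constant :: real
  where "universal_constant = (SOME C. \<forall>(M :: real metric) z D.
    z \<in> mspace M \<longrightarrow> doubling_constant M D \<longrightarrow>
    bounded_approximation_property (C * (1 + ln D)) (Lipschitz_free M z) (dual_norm M z))"

text \<open>The rest of the theory shows that the dual norm induces a metric on every set of bounded
  functionals, so that \<^const>\<open>norm_topology\<close> above is indeed a metric topology.\<close>

lemma mdist_pos:
  assumes "x \<in> mspace M" "y \<in> mspace M" "x \<noteq> y"
  shows "0 < mdist M x y"
  using assms mdist_zero[of x M y] mdist_nonneg[of M x y] by linarith

lemma Lip0_bound:
  assumes "f \<in> Lip0 M z" "x \<in> mspace M" "y \<in> mspace M"
  shows "\<bar>f x - f y\<bar> \<le> Lip_norm M f * mdist M x y"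
proof (cases "x = y")
  case True
  then have "mdist M x y = 0" using assms by simp
  with True show ?thesis by simp
next
  case False
  let ?S = "{\<bar>f x - f y\<bar> / mdist M x y | x y. x \<in> mspace M \<and> y \<in> mspace M \<and> x \<noteq> y}"
  obtain B where B: "\<And>x y. x \<in> mspace M \<Longrightarrow> y \<in> mspace M \<Longrightarrow> \<bar>f x - f y\<bar> \<le> B * mdist M x y"
    using assms(1) unfolding Lip0_def Lipschitz_continuous_map_def
    by (auto simp: dist_real_def)
  have "\<bar>f x - f y\<bar> / mdist M x y \<le> B" if "x \<in> mspace M" "y \<in> mspace M" "x \<noteq> y" for x y
    using B[OF that(1,2)] mdist_pos[OF that] by (simp add: pos_divide_le_eq)
  then have "bdd_above ?S" by (intro bdd_aboveI[of _ B]) blast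
  then have "bdd_above (insert 0 ?S)" by simp
  moreover have "\<bar>f x - f y\<bar> / mdist M x y \<in> insert 0 ?S" using assms False by blast
  ultimately have "\<bar>f x - f y\<bar> / mdist M x y \<le> Lip_norm M f"
    unfolding Lip_norm_def by (intro cSup_upper)
  then show ?thesis using mdist_pos[OF assms(2,3) False] by (simp add: pos_divide_le_eq)
qed

lemma Lip_norm_le:
  assumes "0 \<le> B" "\<And>x y. x \<in> mspace M \<Longrightarrow> y \<in> mspace M \<Longrightarrow> \<bar>f x - f y\<bar> \<le> B * mdist M x y"
  shows "Lip_norm M f \<le> B"
  unfolding Lip_norm_def
proof (rule cSup_least)
  fix t
  assume "t \<in> insert 0 {\<bar>f x - f y\<bar> / mdist M x y | x y. x \<in> mspace M \<and> y \<in> mspace M \<and> x \<noteq> y}"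
  then consider "t = 0" | x y where "t = \<bar>f x - f y\<bar> / mdist M x y"
      "x \<in> mspace M" "y \<in> mspace M" "x \<noteq> y"
    by blast
  then show "t \<le> B"
  proof cases
    case 2
    then show ?thesis using assms(2)[of x y] mdist_pos[of x M y] by (simp add: pos_divide_le_eq)
  qed (use assms in simp)
qed simp

lemma Lip0_scale:
  assumes "f \<in> Lip0 M z"
  shows "c *\<^sub>R f \<in> Lip0 M z" "Lip_norm M (c *\<^sub>R f) \<le> \<bar>c\<bar> * \<bar>Lip_norm M f\<bar>"
proof -
  have b: "\<bar>(c *\<^sub>R f) x - (c *\<^sub>R f) y\<bar> \<le> (\<bar>c\<bar> * \<bar>Lip_norm M f\<bar>) * mdist M x y"
    if "x \<in> mspace M" "y \<in> mspace M" for x y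
  proof -
    have "\<bar>f x - f y\<bar> \<le> \<bar>Lip_norm M f\<bar> * mdist M x y"
      by (meson Lip0_bound[OF assms that] abs_ge_self mdist_nonneg mult_right_mono order_trans)
    then have "\<bar>c\<bar> * \<bar>f x - f y\<bar> \<le> \<bar>c\<bar> * (\<bar>Lip_norm M f\<bar> * mdist M x y)"
      by (simp add: mult_left_mono)
    then show ?thesis
      by (simp add: right_diff_distrib[symmetric] abs_mult mult.assoc)
  qed
  then show "c *\<^sub>R f \<in> Lip0 M z"
    using assms
    unfolding Lip0_def Lipschitz_continuous_map_def
    by (auto simp: dist_real_def)
  show "Lip_norm M (c *\<^sub>R f) \<le> \<bar>c\<bar> * \<bar>Lip_norm M f\<bar>"
    using b by (intro Lip_norm_le) auto
qed

lemma Lip0_zero: "0 \<in> Lip0 M z" "Lip_norm M 0 \<le> 0"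
proof -
  show "0 \<in> Lip0 M z"
    by (auto simp: Lip0_def Lipschitz_continuous_map_def intro!: exI[of _ 0])
  show "Lip_norm M 0 \<le> 0" by (rule Lip_norm_le) auto
qed

lemma subspace_Lip0_dual: "subspace (Lip0_dual M z)"
proof (rule subspaceI)
  show "0 \<in> Lip0_dual M z" by (auto simp: Lip0_dual_def intro!: exI[of _ 0])
next
  fix \<phi> \<psi> assume *: "\<phi> \<in> Lip0_dual M z" "\<psi> \<in> Lip0_dual M z"
  obtain A where A: "\<And>f. f \<in> Lip0 M z \<Longrightarrow> \<bar>\<phi> f\<bar> \<le> A * Lip_norm M f"
    using *(1) unfolding Lip0_dual_def by blast
  obtain B where B: "\<And>f. f \<in> Lip0 M z \<Longrightarrow> \<bar>\<psi> f\<bar> \<le> B * Lip_norm M f"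
    using *(2) unfolding Lip0_dual_def by blast
  have "\<bar>(\<phi> + \<psi>) f\<bar> \<le> (A + B) * Lip_norm M f" if "f \<in> Lip0 M z" for f
    using A[OF that] B[OF that] by (simp add: distrib_right)
  then show "\<phi> + \<psi> \<in> Lip0_dual M z"
    using * by (auto simp: Lip0_dual_def distrib_left)
next
  fix c \<phi> assume *: "\<phi> \<in> Lip0_dual M z"
  then obtain A where "\<And>f. f \<in> Lip0 M z \<Longrightarrow> \<bar>\<phi> f\<bar> \<le> A * Lip_norm M f"
    unfolding Lip0_dual_def by blast
  then have "\<bar>(c *\<^sub>R \<phi>) f\<bar> \<le> (\<bar>c\<bar> * A) * Lip_norm M f" if "f \<in> Lip0 M z" for f
    using that by (simp add: abs_mult mult.assoc mult_left_mono)
  then show "c *\<^sub>R \<phi> \<in> Lip0_dual M z"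
    using * by (auto simp: Lip0_dual_def distrib_left)
qed

lemma Lip_norm_nonneg:
  assumes "f \<in> Lip0 M z"
  shows "0 \<le> Lip_norm M f"
proof (cases "\<exists>x\<in>mspace M. \<exists>y\<in>mspace M. x \<noteq> y")
  case True
  then obtain x y where xy: "x \<in> mspace M" "y \<in> mspace M" "x \<noteq> y" by blast
  have "0 \<le> Lip_norm M f * mdist M x y"
    using Lip0_bound[OF assms xy(1,2)] by linarith
  then show ?thesis using mdist_pos[OF xy] by (simp add: zero_le_mult_iff)
next
  case False
  then have "{\<bar>f x - f y\<bar> / mdist M x y | x y. x \<in> mspace M \<and> y \<in> mspace M \<and> x \<noteq> y} = {}"
    by blast
  then show ?thesis unfolding Lip_norm_def by (simp only: cSup_singleton order_refl)
qed

lemma dual_norm_upper: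
  assumes "\<phi> \<in> Lip0_dual M z" "f \<in> Lip0 M z" "Lip_norm M f \<le> 1"
  shows "\<bar>\<phi> f\<bar> \<le> dual_norm M z \<phi>"
proof -
  obtain B where B: "\<And>f. f \<in> Lip0 M z \<Longrightarrow> \<bar>\<phi> f\<bar> \<le> B * Lip_norm M f"
    using assms(1) unfolding Lip0_dual_def by blast
  have "\<bar>\<phi> g\<bar> \<le> \<bar>B\<bar>" if "g \<in> Lip0 M z" "Lip_norm M g \<le> 1" for g
  proof -
    have "\<bar>\<phi> g\<bar> \<le> \<bar>B\<bar> * Lip_norm M g"
      by (meson B abs_ge_self Lip_norm_nonneg mult_right_mono order_trans that(1))
    also have "\<dots> \<le> \<bar>B\<bar>"
      using mult_left_mono[OF that(2), of "\<bar>B\<bar>"] by simp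
    finally show ?thesis .
  qed
  then have "bdd_above {\<bar>\<phi> f\<bar> | f. f \<in> Lip0 M z \<and> Lip_norm M f \<le> 1}"
    by (auto intro!: bdd_aboveI[of _ "\<bar>B\<bar>"])
  then show ?thesis
    unfolding dual_norm_def using assms by (intro cSup_upper) auto
qed

lemma dual_norm_least:
  assumes "\<And>f. f \<in> Lip0 M z \<Longrightarrow> Lip_norm M f \<le> 1 \<Longrightarrow> \<bar>\<phi> f\<bar> \<le> B"
  shows "dual_norm M z \<phi> \<le> B"
  unfolding dual_norm_def
proof (rule cSup_least)
  have "Lip_norm M 0 \<le> 1" using Lip0_zero(2)[of M] by linarith
  then have "\<bar>\<phi> 0\<bar> \<in> {\<bar>\<phi> f\<bar> | f. f \<in> Lip0 M z \<and> Lip_norm M f \<le> 1}"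
    using Lip0_zero(1)[of M z] by (intro CollectI exI[of _ 0] conjI refl)
  then show "{\<bar>\<phi> f\<bar> | f. f \<in> Lip0 M z \<and> Lip_norm M f \<le> 1} \<noteq> {}"
    by (simp only: ex_in_conv[symmetric]) (rule exI)
next
  fix t assume "t \<in> {\<bar>\<phi> f\<bar> | f. f \<in> Lip0 M z \<and> Lip_norm M f \<le> 1}"
  then obtain f where "t = \<bar>\<phi> f\<bar>" "f \<in> Lip0 M z" "Lip_norm M f \<le> 1" by (elim CollectE exE conjE)
  with assms[of f] show "t \<le> B" by (simp only:)
qed

lemma Metric_space_Lip0_dual:
  assumes Z: "Z \<subseteq> Lip0_dual M z"
  shows "Metric_space Z (norm_dist Z (dual_norm M z))"
proof -
  have diff: "\<phi> - \<psi> \<in> Lip0_dual M z" if "\<phi> \<in> Z" "\<psi> \<in> Z" for \<phi> \<psi>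
    using that Z by (intro subspace_diff[OF subspace_Lip0_dual]) auto
  have nonneg: "0 \<le> dual_norm M z \<phi>" if "\<phi> \<in> Lip0_dual M z" for \<phi>
  proof -
    have "Lip_norm M 0 \<le> 1" using Lip0_zero(2)[of M] by linarith
    from dual_norm_upper[OF that Lip0_zero(1) this] show ?thesis by linarith
  qed
  have definite: "\<phi> = 0" if \<phi>: "\<phi> \<in> Lip0_dual M z" and 0: "dual_norm M z \<phi> = 0" for \<phi>
  proof
    fix f
    show "\<phi> f = 0 f"
    proof (cases "f \<in> Lip0 M z")
      case f: True
      define c where "c = 1 / (1 + \<bar>Lip_norm M f\<bar>)"
      have c: "c > 0" "c * \<bar>Lip_norm M f\<bar> \<le> 1" by (auto simp: c_def)
      have "\<bar>\<phi> (c *\<^sub>R f)\<bar> \<le> 0"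
        using dual_norm_upper[OF \<phi> Lip0_scale(1)[OF f, of c]] Lip0_scale(2)[OF f, of c] c 0
        by simp
      moreover have "\<phi> (c *\<^sub>R f) = c * \<phi> f" using \<phi> f by (simp add: Lip0_dual_def)
      ultimately show ?thesis using c by simp
    qed (use \<phi> in \<open>simp add: Lip0_dual_def\<close>)
  qed
  have minus: "dual_norm M z (\<phi> - \<psi>) = dual_norm M z (\<psi> - \<phi>)" for \<phi> \<psi>
    by (simp add: dual_norm_def abs_minus_commute)
  have zero: "dual_norm M z 0 = 0"
    using dual_norm_least[of M z 0 0] nonneg[OF subspace_0[OF subspace_Lip0_dual]]
    by (simp add: order_antisym)
  have triangle: "dual_norm M z (\<phi> - \<theta>) \<le> dual_norm M z (\<phi> - \<psi>) + dual_norm M z (\<psi> - \<theta>)"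
    if "\<phi> \<in> Z" "\<psi> \<in> Z" "\<theta> \<in> Z" for \<phi> \<psi> \<theta>
  proof (rule dual_norm_least)
    fix f assume "f \<in> Lip0 M z" "Lip_norm M f \<le> 1"
    with dual_norm_upper[OF diff[OF that(1,2)] this] dual_norm_upper[OF diff[OF that(2,3)] this]
    show "\<bar>(\<phi> - \<theta>) f\<bar> \<le> dual_norm M z (\<phi> - \<psi>) + dual_norm M z (\<psi> - \<theta>)"
      by simp
  qed
  show ?thesis
  proof
    fix \<phi> \<psi> assume "\<phi> \<in> Z" "\<psi> \<in> Z"
    then show "norm_dist Z (dual_norm M z) \<phi> \<psi> = 0 \<longleftrightarrow> \<phi> = \<psi>"
      using definite[OF diff, of \<phi> \<psi>] zero unfolding norm_dist_def by auto
  next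
    fix \<phi> \<psi> show "0 \<le> norm_dist Z (dual_norm M z) \<phi> \<psi>"
      using nonneg[OF diff, of \<phi> \<psi>] unfolding norm_dist_def by (auto split: if_split)
  next
    fix \<phi> \<psi> show "norm_dist Z (dual_norm M z) \<phi> \<psi> = norm_dist Z (dual_norm M z) \<psi> \<phi>"
      unfolding norm_dist_def using minus[of \<phi> \<psi>] by (simp add: conj_commute)
  next
    fix \<phi> \<psi> \<theta> assume "\<phi> \<in> Z" "\<psi> \<in> Z" "\<theta> \<in> Z"
    then show "norm_dist Z (dual_norm M z) \<phi> \<theta> \<le>
        norm_dist Z (dual_norm M z) \<phi> \<psi> + norm_dist Z (dual_norm M z) \<psi> \<theta>"
      using triangle unfolding norm_dist_def by simp
  qed
qed

end

theory Submission
  imports Defs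
begin

text \<open>Fix a maximal \<open>e\<close>-separated subset \<open>N\<close> of the ball \<open>B(z, 2R)\<close>, which is finite, and replace a
  function \<open>f\<close> by its average \<open>S f\<close> over \<open>N\<close> with weights proportional to \<open>exp (- a d(x, y))\<close>. For
  \<open>a = 3 (1 + ln D) / e\<close> the decay of the weights beats the growth of \<open>N\<close>, so the averages are
  concentrated at distance \<open>O(e)\<close> from \<open>x\<close>; since the weights are log-Lipschitz with constant \<open>2 a\<close>,
  \<open>S\<close> increases Lipschitz constants by a factor of at most \<open>O(a e) = O(1 + ln D)\<close>, and \<open>S f - f = O(e)\<close>.
  Multiplying \<open>S f - S f(z)\<close> by a cutoff function supported in \<open>B(z, 2R)\<close> costs another factor \<open>3\<close>.
  The resulting operator depends on finitely many values of \<open>f\<close>, hence is the adjoint of a finite-rank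
  operator on the free space, and these operators converge strongly to the identity as \<open>e \<longrightarrow> 0\<close> and
  \<open>R \<longrightarrow> \<infinity>\<close>.

  This gives the constant \<open>147\<close> for all metric spaces over all types. What is known about
  \<^const>\<open>universal_constant\<close> concerns metrics on sets of real numbers only, so the theorem is obtained
  from an isometric copy: a doubling space is separable and embeds as a set into the reals.\<close>

section \<open>Nets in doubling spaces\<close>

lemma mdist_self:
  assumes "x \<in> mspace M"
  shows "mdist M x x = 0"
  using mdist_zero[OF assms assms] by simp

text \<open>Induction on \<open>n\<close>: each ball of the current cover is replaced by at most
  \<open>D\<close> balls of half the radius, so the cardinalities multiply.\<close>

lemma doubling_iterate:
  assumes D: "doubling_constant M D" and p: "p \<in> mspace M" and R: "R > 0"
  shows "\<exists>P. finite P \<and> P \<subseteq> mspace M \<and> real (card P) \<le> D ^ n \<and>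
    mball_of M p R \<subseteq> (\<Union>q\<in>P. mball_of M q (R / 2 ^ n))"
proof (induction n)
  case 0
  show ?case using p by (intro exI[of _ "{p}"]) auto
next
  case (Suc n)
  then obtain P where P: "finite P" "P \<subseteq> mspace M" "real (card P) \<le> D ^ n"
      "mball_of M p R \<subseteq> (\<Union>q\<in>P. mball_of M q (R / 2 ^ n))"
    by blast
  have "\<forall>q\<in>P. \<exists>Q. finite Q \<and> Q \<subseteq> mspace M \<and> real (card Q) \<le> D \<and>
      mball_of M q (R / 2 ^ n) \<subseteq> (\<Union>q\<in>Q. mball_of M q (R / 2 ^ n / 2))"
  proof
    fix q assume "q \<in> P"
    then have "q \<in> mspace M" "0 < R / 2 ^ n" using P(2) R by auto
    then show "\<exists>Q. finite Q \<and> Q \<subseteq> mspace M \<and> real (card Q) \<le> D \<and>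
        mball_of M q (R / 2 ^ n) \<subseteq> (\<Union>q\<in>Q. mball_of M q (R / 2 ^ n / 2))"
      using D unfolding doubling_constant_def by blast
  qed
  then obtain Q where Q: "\<And>q. q \<in> P \<Longrightarrow> finite (Q q) \<and> Q q \<subseteq> mspace M \<and> real (card (Q q)) \<le> D \<and>
      mball_of M q (R / 2 ^ n) \<subseteq> (\<Union>q\<in>Q q. mball_of M q (R / 2 ^ n / 2))"
    by metis
  have "real (card (\<Union>q\<in>P. Q q)) \<le> real (\<Sum>q\<in>P. card (Q q))"
    using P(1) by (intro of_nat_mono card_UN_le)
  also have "\<dots> \<le> real (card P) * D"
    using sum_mono[of P "\<lambda>q. real (card (Q q))" "\<lambda>q. D"] Q by simp
  also have "\<dots> \<le> D ^ Suc n"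
    using P(3) D by (simp add: doubling_constant_def mult.commute)
  finally have "real (card (\<Union>q\<in>P. Q q)) \<le> D ^ Suc n" .
  moreover have "mball_of M p R \<subseteq> (\<Union>q\<in>(\<Union>q\<in>P. Q q). mball_of M q (R / 2 ^ Suc n))"
  proof
    fix x assume "x \<in> mball_of M p R"
    then obtain q where q: "q \<in> P" "x \<in> mball_of M q (R / 2 ^ n)" using P(4) by blast
    then obtain u where "u \<in> Q q" "x \<in> mball_of M u (R / 2 ^ n / 2)" using Q by blast
    then show "x \<in> (\<Union>q\<in>(\<Union>q\<in>P. Q q). mball_of M q (R / 2 ^ Suc n))"
      using q by (auto simp: field_simps)
  qed
  ultimately show ?case using P(1) Q by (intro exI[of _ "\<Union>q\<in>P. Q q"]) auto
qed

text \<open>A cover of the nonempty ball around \<open>z\<close> has at least one member. This makes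
  \<open>ln D\<close> nonnegative in all later estimates.\<close>

lemma doubling_constant_ge_1:
  assumes "doubling_constant M D" "z \<in> mspace M"
  shows "1 \<le> D"
proof -
  obtain P where P: "finite P" "real (card P) \<le> D" "mball_of M z 1 \<subseteq> (\<Union>q\<in>P. mball_of M q (1 / 2))"
    using assms unfolding doubling_constant_def by (meson zero_less_one)
  have "z \<in> mball_of M z 1" using assms(2) by (simp add: mdist_self)
  then have "P \<noteq> {}" using P(3) by blast
  then have "1 \<le> card P" using P(1) by (simp add: Suc_le_eq card_gt_0_iff)
  then show ?thesis using P(2) by linarith
qed

definition separated :: "'a metric \<Rightarrow> real \<Rightarrow> 'a set \<Rightarrow> bool"
  where "separated M e N \<longleftrightarrow> (\<forall>x\<in>N. \<forall>y\<in>N. x \<noteq> y \<longrightarrow> e \<le> mdist M x y)"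

text \<open>A ball of radius \<open>e / 2\<close> contains at most one point of an
  \<open>e\<close>-separated set, so sending each point to a ball of the cover that contains it is
  injective. The radius is written so that \<open>n\<close> halvings end exactly at
  \<open>e / 2\<close>.\<close>

lemma card_separated:
  assumes D: "doubling_constant M D" and p: "p \<in> mspace M" and e: "e > 0"
    and N: "separated M e N" "N \<subseteq> mball_of M p (2 ^ n * (e / 2))"
  shows "finite N" "real (card N) \<le> D ^ n"
proof -
  obtain P where P: "finite P" "P \<subseteq> mspace M" "real (card P) \<le> D ^ n"
      "mball_of M p (2 ^ n * (e / 2)) \<subseteq> (\<Union>q\<in>P. mball_of M q (2 ^ n * (e / 2) / 2 ^ n))"
    using doubling_iterate[OF D p, of "2 ^ n * (e / 2)" n] e by auto
  have "\<forall>y\<in>N. \<exists>q\<in>P. y \<in> mball_of M q (e / 2)"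
    using N(2) P(4) by (force simp: subset_iff)
  then obtain f where f: "\<And>y. y \<in> N \<Longrightarrow> f y \<in> P \<and> y \<in> mball_of M (f y) (e / 2)" by metis
  have "inj_on f N"
  proof (rule inj_onI, rule ccontr)
    fix x y assume xy: "x \<in> N" "y \<in> N" "f x = f y" "x \<noteq> y"
    have "mdist M x y \<le> mdist M x (f x) + mdist M (f x) y"
      using f[OF xy(1)] f[OF xy(2)] P(2) xy(3) by (intro mdist_triangle) auto
    also have "\<dots> < e"
      using f[OF xy(1)] f[OF xy(2)] xy(3) by (auto simp: mdist_commute[of M x])
    finally show False using N(1) xy unfolding separated_def by fastforce
  qed
  moreover have "f ` N \<subseteq> P" using f by auto
  ultimately show "finite N" "real (card N) \<le> D ^ n"
    using P inj_on_finite card_inj_on_le[of f N P] by force+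
qed

text \<open>Separated subsets of the ball have bounded cardinality, so one of largest cardinality
  exists. It is \<open>e\<close>-dense in the ball, because a point at distance at least
  \<open>e\<close> from all of it could be added.\<close>

lemma obtain_net:
  assumes D: "doubling_constant M D" and p: "p \<in> mspace M" and e: "e > 0"
  obtains N where "finite N" "N \<subseteq> mcball_of M p R" "separated M e N"
    "\<And>x. x \<in> mcball_of M p R \<Longrightarrow> \<exists>y\<in>N. mdist M x y < e"
proof -
  obtain n where n: "R / (e / 2) < 2 ^ n" using real_arch_pow[of 2] by auto
  then have "R < 2 ^ n * (e / 2)" using e by (simp add: field_simps)
  then have sub: "mcball_of M p R \<subseteq> mball_of M p (2 ^ n * (e / 2))" by auto
  let ?P = "\<lambda>N. N \<subseteq> mcball_of M p R \<and> separated M e N"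
  have fin: "finite N \<and> card N \<le> nat \<lfloor>D ^ n\<rfloor>" if "?P N" for N
  proof -
    have "N \<subseteq> mball_of M p (2 ^ n * (e / 2))" using that sub by blast
    from card_separated[OF D p e _ this] that show ?thesis by (simp add: le_nat_floor)
  qed
  have "?P {}" by (auto simp: separated_def)
  moreover have "card N < Suc (nat \<lfloor>D ^ n\<rfloor>)" if "?P N" for N using fin[OF that] by simp
  ultimately obtain N where N: "?P N" "\<And>N'. ?P N' \<Longrightarrow> card N' \<le> card N"
    using Lattices_Big.ex_has_greatest_nat[of ?P "{}" card "Suc (nat \<lfloor>D ^ n\<rfloor>)"] by blast
  show ?thesis
  proof
    show "finite N" "N \<subseteq> mcball_of M p R" "separated M e N" using N fin by auto
    fix x assume x: "x \<in> mcball_of M p R"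
    show "\<exists>y\<in>N. mdist M x y < e"
    proof (rule ccontr)
      assume far: "\<not> ?thesis"
      then have "x \<notin> N" using x e by (auto simp: mdist_self)
      have "?P (insert x N)"
      proof -
        have "e \<le> mdist M x y \<and> e \<le> mdist M y x" if "y \<in> N" for y
          using far that by (auto simp: mdist_commute not_less)
        then show ?thesis using N(1) x unfolding separated_def by blast
      qed
      from N(2)[OF this] \<open>x \<notin> N\<close> fin[OF N(1)] show False by simp
    qed
  qed
qed

section \<open>Averaging with exponential weights\<close>

text \<open>A partition of unity over \<open>N\<close> of softmax type. Exponentials turn an
  additive change of the distances into a multiplicative change of the weights, so the cardinality
  of \<open>N\<close> does not enter the Lipschitz estimates.\<close>

definition weight :: "'a metric \<Rightarrow> 'a set \<Rightarrow> real \<Rightarrow> 'a \<Rightarrow> 'a \<Rightarrow> real"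
  where "weight M N a y x = exp (- a * mdist M x y) / (\<Sum>u\<in>N. exp (- a * mdist M x u))"

lemma weight_nonneg: "0 \<le> weight M N a y x"
  unfolding weight_def by (intro divide_nonneg_nonneg sum_nonneg) auto

lemma sum_weight:
  assumes "finite N" "N \<noteq> {}"
  shows "(\<Sum>y\<in>N. weight M N a y x) = 1"
proof -
  have "(\<Sum>u\<in>N. exp (- a * mdist M x u)) > 0" using assms by (intro sum_pos) auto
  then show ?thesis unfolding weight_def by (simp add: sum_divide_distrib[symmetric])
qed

lemma weight_le_1:
  assumes "finite N" "y \<in> N"
  shows "weight M N a y x \<le> 1"
  using sum_weight[OF assms(1), of M a x] member_le_sum[of y N "\<lambda>y. weight M N a y x"] assms
    weight_nonneg by (metis empty_iff)

text \<open>Moving from \<open>x\<close> to \<open>x'\<close> changes every distance by at most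
  \<open>mdist M x x'\<close>, hence the numerator and the denominator each by a factor of at most
  \<open>exp (a * mdist M x x')\<close>; together they produce the 2.\<close>

lemma weight_ratio:
  assumes N: "finite N" "N \<subseteq> mspace M" "y \<in> N" and x: "x \<in> mspace M" "x' \<in> mspace M"
    and a: "0 \<le> a"
  shows "weight M N a y x' \<le> exp (2 * a * mdist M x x') * weight M N a y x"
proof -
  \<comment> \<open>Stated for both orders of the two points: the numerator is compared in one
    direction and the denominator in the other.\<close>
  have e: "exp (- a * mdist M v u) \<le> exp (a * mdist M x x') * exp (- a * mdist M w u)"
    if "u \<in> N" "{v, w} = {x, x'}" for u v w
  proof -
    have uvw: "u \<in> mspace M" "v \<in> mspace M" "w \<in> mspace M" using that x N(2) by (auto simp: doubleton_eq_iff)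
    have "mdist M w v = mdist M x x'" using that(2) by (auto simp: doubleton_eq_iff mdist_commute)
    then have "mdist M w u \<le> mdist M x x' + mdist M v u"
      using mdist_triangle[OF uvw(3,2,1)] by simp
    from mult_left_mono[OF this a] show ?thesis
      by (simp add: exp_add[symmetric] algebra_simps)
  qed
  define S where "S v = (\<Sum>u\<in>N. exp (- a * mdist M v u))" for v
  have S: "S v > 0" for v unfolding S_def using N by (intro sum_pos) auto
  have "S x \<le> exp (a * mdist M x x') * S x'"
    unfolding S_def sum_distrib_left by (intro sum_mono e) auto
  then have "exp (- a * mdist M x' y) * S x \<le>
      (exp (a * mdist M x x') * exp (- a * mdist M x y)) * (exp (a * mdist M x x') * S x')"
    using e[OF N(3), of x' x] S[of x] by (intro mult_mono) auto
  also have "\<dots> = exp (2 * a * mdist M x x') * exp (- a * mdist M x y) * S x'"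
    by (simp add: exp_add[symmetric] algebra_simps)
  finally show ?thesis
    unfolding weight_def S_def[symmetric] using S[of x] S[of x'] by (simp add: field_simps)
qed

text \<open>Linearizes \<open>weight_ratio\<close> by \<open>exp t \<le> 1 + 2 * t\<close> on the
  unit interval. The bound stays proportional to the weight at \<open>x\<close>, so that it can
  later be summed against the distances from \<open>x\<close>.\<close>

lemma weight_diff:
  assumes N: "finite N" "N \<subseteq> mspace M" "y \<in> N" and x: "x \<in> mspace M" "x' \<in> mspace M"
    and a: "0 \<le> a" and small: "2 * a * mdist M x x' \<le> 1"
  shows "\<bar>weight M N a y x' - weight M N a y x\<bar> \<le> 4 * a * mdist M x x' * weight M N a y x"
proof -
  define t where "t = 2 * a * mdist M x x'"
  define w where "w = weight M N a y x"
  define w' where "w' = weight M N a y x'"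
  have t: "0 \<le> t" "t \<le> 1" unfolding t_def using a small by auto
  have exp: "exp t \<le> 1 + 2 * t"
    using exp_bound[OF t] t by (simp add: power2_eq_square) (smt (verit) mult_left_le)
  have nn: "0 \<le> w" "0 \<le> w'" by (simp_all add: w_def w'_def weight_nonneg)
  have "w' \<le> exp t * w" "w \<le> exp t * w'"
    using weight_ratio[OF N x a] weight_ratio[OF N x(2,1) a]
    by (simp_all add: w_def w'_def t_def mdist_commute)
  then have 1: "w' \<le> (1 + 2 * t) * w" "w \<le> (1 + 2 * t) * w'"
    using mult_right_mono[OF exp nn(1)] mult_right_mono[OF exp nn(2)] by linarith+
  \<comment> \<open>The second inequality of \<open>1\<close> measures the error by
    \<open>w'\<close>; in the only nontrivial case \<open>w'\<close> is at most \<open>w\<close> and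
    can be replaced by it.\<close>
  have "w - w' \<le> 2 * t * w"
  proof (cases "w' \<le> w")
    case True
    then have "t * w' \<le> t * w" using t by (simp add: mult_left_mono)
    then show ?thesis using 1(2) by (simp add: algebra_simps)
  next
    case False
    then have "w - w' \<le> 0" by simp
    also have "0 \<le> 2 * t * w" using t nn by simp
    finally show ?thesis .
  qed
  then have "\<bar>w' - w\<bar> \<le> 2 * t * w" using 1(1) by (simp add: algebra_simps abs_le_iff)
  then show ?thesis by (simp add: w_def w'_def t_def)
qed

text \<open>Weights lie between 0 and 1, which settles distances above \<open>1 / (2 * a)\<close>;
  below, \<open>weight_diff\<close> applies. The lemma serves to place the functions built from
  single weights in \<open>Lip0\<close>; the norm estimate of the operator comes from
  \<open>average_Lipschitz\<close> instead.\<close>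

lemma weight_Lipschitz:
  assumes N: "finite N" "N \<subseteq> mspace M" "y \<in> N" and x: "x \<in> mspace M" "x' \<in> mspace M"
    and a: "0 \<le> a"
  shows "\<bar>weight M N a y x - weight M N a y x'\<bar> \<le> 4 * a * mdist M x x'"
proof (cases "2 * a * mdist M x x' \<le> 1")
  case True
  have "4 * a * mdist M x x' * weight M N a y x \<le> 4 * a * mdist M x x'"
    using a weight_le_1[OF N(1,3)] by (intro mult_right_le_one_le) (auto simp: weight_nonneg)
  then show ?thesis using weight_diff[OF N x a True] by (simp add: abs_minus_commute)
next
  case False
  moreover have "\<bar>weight M N a y x - weight M N a y x'\<bar> \<le> 1"
    using weight_le_1[OF N(1,3)] weight_nonneg by (smt (verit))
  ultimately show ?thesis by linarith
qed

text \<open>The points of the net with \<open>2\<^sup>k e \<le> d(x, y) < 2\<^sup>k\<^sup>+\<^sup>1 e\<close> number at most \<open>D\<^sup>k\<^sup>+\<^sup>2\<close>, and the rate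
  \<open>3 (1 + ln D) / e\<close> is what makes the exponential decay beat this growth.\<close>

lemma weight_moment:
  assumes D: "doubling_constant M D" and e: "e > 0"
    and N: "finite N" "N \<subseteq> mspace M" "separated M e N"
    and x: "x \<in> mspace M" and near: "\<exists>y\<in>N. mdist M x y < e"
  defines "a \<equiv> 3 * (1 + ln D) / e"
  shows "(\<Sum>y\<in>N. weight M N a y x * mdist M x y) \<le> 4 * e"
proof -
  have D1: "1 \<le> D" using doubling_constant_ge_1[OF D x] .
  define S where "S = (\<Sum>u\<in>N. exp (- a * mdist M x u))"
  \<comment> \<open>The exponential at distance exactly \<open>e\<close>. The net point near
    \<open>x\<close> makes it a lower bound for the normalizing sum \<open>S\<close>.\<close>
  define q where "q = exp (- (a * e))"
  define g where "g y = exp (- a * mdist M x y) * mdist M x y" for y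
  have a: "0 < a" unfolding a_def using D1 e by (simp add: add_pos_nonneg)
  obtain y0 where y0: "y0 \<in> N" "mdist M x y0 < e" using near by blast
  have "q \<le> exp (- a * mdist M x y0)" unfolding q_def using y0(2) a by simp
  also have "\<dots> \<le> S" unfolding S_def using N(1) y0(1) by (intro member_le_sum) auto
  finally have qS: "q \<le> S" .
  have q0: "0 < q" unfolding q_def by simp
  have ae: "a * e = 3 + 3 * ln D" unfolding a_def using e by simp
  \<comment> \<open>Here the rate is used: \<open>3 * ln D\<close> cancels \<open>D ^ 3\<close>, and
    the remaining \<open>exp (-3)\<close> is at most \<open>1 / 8\<close> because
    \<open>exp 1\<close> is at least 2.\<close>
  have q8: "8 * D ^ 3 * q \<le> 1"
  proof -
    have "q = exp (- 3) * exp (- (3 * ln D))"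
      unfolding q_def ae by (simp add: exp_add[symmetric])
    also have "exp (3 * ln D) = D ^ 3"
      using D1 exp_of_nat_mult[of 3 "ln D"] by simp
    then have "exp (- (3 * ln D)) = 1 / D ^ 3" by (simp add: exp_minus field_simps)
    finally have "8 * D ^ 3 * q = 8 / exp (3::real)" using D1 by (simp add: exp_minus field_simps)
    moreover have "(2::real) ^ 3 \<le> exp 1 ^ 3" using exp_ge_add_one_self[of 1] by (intro power_mono) auto
    then have "8 \<le> exp (3::real)" using exp_of_nat_mult[of 3 "1::real"] by simp
    ultimately show ?thesis by simp
  qed
  define F where "F = {y \<in> N. 2 * e \<le> mdist M x y}"
  \<comment> \<open>The index of the dyadic shell of \<open>y\<close>. Points of \<open>F\<close>
    have distance at least \<open>2 * e\<close>, so their level is at least 1 and minimality can be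
    applied to \<open>lev y - 1\<close>.\<close>
  define lev where "lev y = (LEAST k. mdist M x y < 2 ^ k * (2 * e))" for y
  have lev: "mdist M x y < 2 ^ lev y * (2 * e)" "2 ^ lev y * e \<le> mdist M x y" "1 \<le> lev y"
    if "y \<in> F" for y
  proof -
    obtain n where "mdist M x y / (2 * e) < 2 ^ n" using real_arch_pow[of 2] by auto
    then have "mdist M x y < 2 ^ n * (2 * e)" using e by (simp add: field_simps)
    then show l: "mdist M x y < 2 ^ lev y * (2 * e)" unfolding lev_def by (rule LeastI)
    show 1: "1 \<le> lev y"
    proof (rule ccontr)
      assume "\<not> 1 \<le> lev y"
      then have "lev y = 0" by simp
      then show False using l that unfolding F_def by simp
    qed
    have "\<not> mdist M x y < 2 ^ (lev y - 1) * (2 * e)"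
      using 1 unfolding lev_def by (intro not_less_Least) linarith
    moreover have "(2::real) ^ lev y = 2 * 2 ^ (lev y - 1)" using 1 by (cases "lev y") auto
    ultimately show "2 ^ lev y * e \<le> mdist M x y" by simp
  qed
  \<comment> \<open>The outer radius \<open>2 ^ k * (2 * e)\<close> equals
    \<open>2 ^ (k + 2) * (e / 2)\<close>, whence the exponent \<open>k + 2\<close> in the count.
    Since \<open>k \<ge> 1\<close>, this exponent is at most \<open>3 * k\<close>, and the shell
    sums decay geometrically with ratio \<open>2 * D ^ 3 * q\<close>, which is at most
    \<open>1 / 4\<close>.\<close>
  have shell: "sum g {y \<in> F. lev y = k} \<le> 2 * e * q * (1 / 2) ^ k" if k: "1 \<le> k" for k
  proof -
    let ?A = "{y \<in> F. lev y = k}"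
    have "?A \<subseteq> mball_of M x (2 ^ (k + 2) * (e / 2))"
    proof
      fix y assume y: "y \<in> ?A"
      then have "mdist M x y < 2 ^ k * (2 * e)" "y \<in> N" using lev(1)[of y] by (auto simp: F_def)
      then show "y \<in> mball_of M x (2 ^ (k + 2) * (e / 2))" using x N(2) by (auto simp: mult_ac)
    qed
    moreover have "separated M e ?A" using N(3) unfolding separated_def F_def by blast
    ultimately have card: "real (card ?A) \<le> D ^ (k + 2)"
      using card_separated(2)[OF D x e] by blast
    have bound: "g y \<le> q ^ (k + 1) * (2 ^ k * (2 * e))" if y: "y \<in> ?A" for y
    proof -
      \<comment> \<open>Weakening \<open>2 ^ k\<close> to \<open>k + 1\<close> yields powers of
        \<open>q\<close>. The extra factor \<open>q\<close> beyond \<open>q ^ k\<close> stays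
        outside the geometric sum and is finally absorbed by \<open>S\<close>.\<close>
      have "k + 1 \<le> 2 ^ k" using less_exp[of k] by (simp add: Suc_le_eq)
      then have "real (k + 1) * e \<le> 2 ^ k * e" using e by (simp add: of_nat_mono[of "k+1" "2^k", simplified])
      then have "real (k + 1) * e \<le> mdist M x y" using lev(2)[of y] y by simp
      from mult_left_mono[OF this, of a] have "exp (- a * mdist M x y) \<le> exp (- (real (k + 1) * (a * e)))"
        using a by (simp add: algebra_simps)
      also have "\<dots> = q ^ (k + 1)" unfolding q_def by (subst exp_of_nat_mult[symmetric]) (simp add: algebra_simps)
      finally show ?thesis unfolding g_def using lev(1)[of y] y q0 by (intro mult_mono) auto
    qed
    have "sum g ?A \<le> real (card ?A) * (q ^ (k + 1) * (2 ^ k * (2 * e)))"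
      using sum_mono[of ?A g "\<lambda>y. q ^ (k + 1) * (2 ^ k * (2 * e))"] bound by simp
    also have "\<dots> \<le> D ^ (3 * k) * (q ^ (k + 1) * (2 ^ k * (2 * e)))"
    proof -
      have "D ^ (k + 2) \<le> D ^ (3 * k)" using k D1 by (intro power_increasing) auto
      then show ?thesis using card e q0 by (intro mult_right_mono) auto
    qed
    also have "\<dots> = 2 * e * q * (2 * D ^ 3 * q) ^ k"
      by (simp add: power_mult power_mult_distrib)
    also have "\<dots> \<le> 2 * e * q * (1 / 2) ^ k"
      using q8 q0 D1 e mult_nonneg_nonneg[of "D^3" q] by (intro mult_left_mono power_mono) auto
    finally show ?thesis .
  qed
  have finF: "finite F" unfolding F_def using N(1) by simp
  have far: "sum g F \<le> e * q * 2"
  proof -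
    define K where "K = lev ` F"
    have "sum g F = (\<Sum>k\<in>K. sum g {y \<in> F. lev y = k})"
      unfolding K_def using sum.group[OF finF finite_imageI[OF finF], of lev lev g] by simp
    also have "\<dots> \<le> (\<Sum>k\<in>K. 2 * e * q * (1 / 2) ^ k)"
      using lev(3) by (intro sum_mono shell) (auto simp: K_def)
    also have "\<dots> = 2 * e * q * (\<Sum>k\<in>K. (1 / 2) ^ k)" by (simp add: sum_distrib_left)
    also have "\<dots> \<le> 2 * e * q * 1"
    proof -
      have "(\<lambda>k. (1 / 2 :: real) ^ Suc k) sums 1" by (rule power_half_series)
      then have *: "summable (\<lambda>k. (1 / 2 :: real) ^ Suc k)" "(\<Sum>k. (1 / 2 :: real) ^ Suc k) = 1"
        by (auto simp: sums_iff)
      \<comment> \<open>All levels are at least 1, so the index can be shifted by one to compare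
        with the series whose sum is 1, not 2.\<close>
      have "(\<Sum>k\<in>K. (1 / 2 :: real) ^ k) = (\<Sum>k\<in>(\<lambda>k. k - 1) ` K. (1 / 2) ^ Suc k)"
      proof (rule sum.reindex_bij_witness[of _ Suc "\<lambda>k. k - 1"])
        fix k assume "k \<in> K"
        then show k: "Suc (k - 1) = k" using lev(3) by (force simp: K_def)
        show "(1 / 2 :: real) ^ Suc (k - 1) = (1 / 2) ^ k" by (simp only: k)
        show "k - 1 \<in> (\<lambda>k. k - 1) ` K" using \<open>k \<in> K\<close> by blast
      next
        fix k assume "k \<in> (\<lambda>k. k - 1) ` K"
        then obtain j where j: "j \<in> K" "k = j - 1" by blast
        moreover have "1 \<le> j" using j lev(3) by (force simp: K_def)
        ultimately show "Suc k - 1 = k" "Suc k \<in> K" by auto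
      qed
      also have "\<dots> \<le> 1"
        using sum_le_suminf[OF *(1), of "(\<lambda>k. k - 1) ` K"] *(2) finF by (simp add: K_def)
      finally show ?thesis using e q0 by (intro mult_left_mono) auto
    qed
    finally show ?thesis by simp
  qed
  \<comment> \<open>Near points contribute at most \<open>2 * e * S\<close> since their distances
    are below \<open>2 * e\<close>; far points contribute at most \<open>2 * e * q\<close>, which is
    no larger.\<close>
  have "sum g (N - F) \<le> (\<Sum>y\<in>N - F. exp (- a * mdist M x y) * (2 * e))"
    unfolding g_def F_def by (intro sum_mono mult_left_mono) auto
  also have "\<dots> = (\<Sum>y\<in>N - F. exp (- a * mdist M x y)) * (2 * e)" by (simp add: sum_distrib_right)
  also have "\<dots> \<le> S * (2 * e)"
    unfolding S_def using N(1) e by (intro mult_right_mono sum_mono2) auto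
  finally have "sum g (N - F) \<le> S * (2 * e)" .
  moreover have "sum g N = sum g (N - F) + sum g F"
    using N(1) by (intro sum.subset_diff) (auto simp: F_def)
  moreover have "e * q * 2 \<le> S * (2 * e)" using qS e by simp
  ultimately have "sum g N \<le> 4 * (e * S)" using far by (simp add: mult_ac)
  have "(\<Sum>y\<in>N. weight M N a y x * mdist M x y) = sum g N / S"
    unfolding weight_def S_def[symmetric] g_def by (simp add: sum_divide_distrib)
  also have "\<dots> \<le> 4 * e"
    using \<open>sum g N \<le> 4 * (e * S)\<close> q0 qS by (simp add: pos_divide_le_eq mult.assoc)
  finally show ?thesis .
qed

definition average :: "'a metric \<Rightarrow> 'a set \<Rightarrow> real \<Rightarrow> ('a \<Rightarrow> real) \<Rightarrow> 'a \<Rightarrow> real"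
  where "average M N a f x = (\<Sum>y\<in>N. f y * weight M N a y x)"

text \<open>The weights sum to 1, so the error is the weighted mean of \<open>f y - f x\<close>,
  which the first moment of the weights controls.\<close>

lemma average_approx:
  assumes N: "finite N" "N \<noteq> {}" "N \<subseteq> mspace M" and x: "x \<in> mspace M"
    and l: "\<And>y. y \<in> N \<Longrightarrow> \<bar>f y - f x\<bar> \<le> l * mdist M x y"
    and m: "(\<Sum>y\<in>N. weight M N a y x * mdist M x y) \<le> c" and l0: "0 \<le> l"
  shows "\<bar>average M N a f x - f x\<bar> \<le> l * c"
proof -
  have "average M N a f x - f x = (\<Sum>y\<in>N. (f y - f x) * weight M N a y x)"
    unfolding average_def left_diff_distrib sum_subtractf
    using sum_weight[OF N(1,2), of M a x] by (simp add: sum_distrib_left[symmetric])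
  also have "\<bar>\<dots>\<bar> \<le> (\<Sum>y\<in>N. \<bar>(f y - f x) * weight M N a y x\<bar>)" by (rule sum_abs)
  also have "\<dots> \<le> (\<Sum>y\<in>N. l * (weight M N a y x * mdist M x y))"
  proof (rule sum_mono)
    fix y assume "y \<in> N"
    from mult_right_mono[OF l[OF this] weight_nonneg]
    show "\<bar>(f y - f x) * weight M N a y x\<bar> \<le> l * (weight M N a y x * mdist M x y)"
      by (simp add: abs_mult weight_nonneg mult_ac)
  qed
  also have "\<dots> \<le> l * c" using mult_left_mono[OF m l0] by (simp add: sum_distrib_left)
  finally show ?thesis .
qed

text \<open>As both families of weights sum to 1, \<open>f x\<close> can be subtracted inside the
  sum of weight differences; \<open>weight_diff\<close> then leaves \<open>4 * a\<close> times the
  first moment. At distances above \<open>1 / (2 * a)\<close> both averages are compared with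
  \<open>f\<close> itself, and the error \<open>2 * l * c\<close> is less than the allowed multiple
  of the distance.\<close>

lemma average_Lipschitz:
  assumes N: "finite N" "N \<noteq> {}" "N \<subseteq> mspace M" and x: "x \<in> mspace M" "x' \<in> mspace M"
    and l: "\<And>x y. x \<in> mspace M \<Longrightarrow> y \<in> mspace M \<Longrightarrow> \<bar>f x - f y\<bar> \<le> l * mdist M x y" and l0: "0 \<le> l"
    and m: "(\<Sum>y\<in>N. weight M N a y x * mdist M x y) \<le> c"
      "(\<Sum>y\<in>N. weight M N a y x' * mdist M x' y) \<le> c"
    and a: "0 \<le> a"
  shows "\<bar>average M N a f x - average M N a f x'\<bar> \<le> l * (1 + 4 * a * c) * mdist M x x'"
proof (cases "2 * a * mdist M x x' \<le> 1")
  case True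
  define d where "d = mdist M x x'"
  have d: "0 \<le> d" unfolding d_def by simp
  have "average M N a f x' - average M N a f x =
      (\<Sum>y\<in>N. (f y - f x) * (weight M N a y x' - weight M N a y x))"
    unfolding average_def left_diff_distrib right_diff_distrib sum_subtractf
    using sum_weight[OF N(1,2), of M a x] sum_weight[OF N(1,2), of M a x']
    by (simp add: sum_distrib_left[symmetric])
  also have "\<bar>\<dots>\<bar> \<le> (\<Sum>y\<in>N. \<bar>(f y - f x) * (weight M N a y x' - weight M N a y x)\<bar>)"
    by (rule sum_abs)
  also have "\<dots> \<le> (\<Sum>y\<in>N. l * (4 * a * d) * (weight M N a y x * mdist M x y))"
  proof (rule sum_mono)
    fix y assume y: "y \<in> N"
    have "\<bar>f y - f x\<bar> \<le> l * mdist M x y"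
      using l[of y x] y N(3) x(1) by (simp add: mdist_commute subset_iff)
    then have "\<bar>(f y - f x) * (weight M N a y x' - weight M N a y x)\<bar> \<le>
        (l * mdist M x y) * (4 * a * d * weight M N a y x)"
      unfolding abs_mult d_def
      using weight_diff[OF N(1,3) y x a True] l0 by (intro mult_mono) auto
    then show "\<bar>(f y - f x) * (weight M N a y x' - weight M N a y x)\<bar> \<le>
        l * (4 * a * d) * (weight M N a y x * mdist M x y)"
      by (simp add: mult_ac)
  qed
  also have "\<dots> \<le> l * (4 * a * d) * c"
    unfolding sum_distrib_left[symmetric] using m(1) l0 a d by (intro mult_left_mono) auto
  also have "\<dots> \<le> l * (1 + 4 * a * c) * d"
    using mult_nonneg_nonneg[OF l0 d] by (simp add: algebra_simps)
  finally show ?thesis by (simp add: d_def abs_minus_commute)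
next
  case False
  have "0 \<le> (\<Sum>y\<in>N. weight M N a y x * mdist M x y)"
    by (intro sum_nonneg mult_nonneg_nonneg weight_nonneg) auto
  then have c: "0 \<le> c" using m(1) by linarith
  have "\<bar>average M N a f x - f x\<bar> \<le> l * c"
    using N x m l0 l by (intro average_approx) (auto simp: mdist_commute[of M x] subset_iff)
  moreover have "\<bar>average M N a f x' - f x'\<bar> \<le> l * c"
    using N x m l0 l by (intro average_approx) (auto simp: mdist_commute[of M x'] subset_iff)
  moreover have "\<bar>f x - f x'\<bar> \<le> l * mdist M x x'" using l x by blast
  moreover have "l * c * 1 \<le> l * c * (2 * a * mdist M x x')"
    using False l0 c by (intro mult_left_mono) auto
  ultimately show ?thesis by (simp add: algebra_simps)
qed

section \<open>Cutting off a Lipschitz function\<close>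

text \<open>The factor is 1 up to distance \<open>R\<close> from \<open>z\<close>, 0 beyond
  \<open>2 * R\<close>, and linear in the distance in between. The value 0 off
  \<open>mspace M\<close> matches the convention of \<open>Lip0\<close>.\<close>

definition cutoff :: "'a metric \<Rightarrow> 'a \<Rightarrow> real \<Rightarrow> ('a \<Rightarrow> real) \<Rightarrow> 'a \<Rightarrow> real"
  where "cutoff M z R g x =
    (if x \<in> mspace M then max 0 (min 1 (2 - mdist M z x / R)) * g x else 0)"

text \<open>Product rule: the factor is at most 1, which costs \<open>L\<close>; it is
  \<open>1 / R\<close>-Lipschitz while \<open>g\<close>, vanishing at \<open>z\<close>, is at most
  \<open>2 * R * L\<close> on the ball, which costs \<open>2 * L\<close>. Control of
  \<open>g\<close> on the ball suffices because the factor vanishes outside.\<close>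

lemma cutoff_Lipschitz:
  assumes z: "z \<in> mspace M" and R: "R > 0" and L: "0 \<le> L" and g0: "g z = 0"
    and g: "\<And>x y. x \<in> mcball_of M z (2 * R) \<Longrightarrow> y \<in> mcball_of M z (2 * R) \<Longrightarrow>
      \<bar>g x - g y\<bar> \<le> L * mdist M x y"
    and x: "x \<in> mspace M" and y: "y \<in> mspace M"
  shows "\<bar>cutoff M z R g x - cutoff M z R g y\<bar> \<le> 3 * L * mdist M x y"
proof -
  define \<phi> where "\<phi> x = max 0 (min 1 (2 - mdist M z x / R))" for x
  have diff: "\<bar>\<phi> x - \<phi> y\<bar> \<le> mdist M x y / R" if "x \<in> mspace M" "y \<in> mspace M" for x y
  proof -
    have "\<bar>mdist M z x - mdist M z y\<bar> \<le> mdist M x y"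
      using mdist_triangle[OF z that] mdist_triangle[OF z that(2,1)] by (simp add: mdist_commute[of M y])
    then have "\<bar>mdist M z x / R - mdist M z y / R\<bar> \<le> mdist M x y / R"
      using R by (simp add: diff_divide_distrib[symmetric] divide_right_mono)
    then show ?thesis unfolding \<phi>_def by linarith
  qed
  have out: "\<phi> x = 0" if "x \<in> mspace M" "x \<notin> mcball_of M z (2 * R)" for x
    using that z R by (simp add: \<phi>_def field_simps)
  \<comment> \<open>Only \<open>y\<close> has to lie in the ball: if \<open>x\<close> lies outside,
    this term is the whole difference.\<close>
  have prod: "\<bar>(\<phi> x - \<phi> y) * g y\<bar> \<le> 2 * L * mdist M x y"
    if "x \<in> mspace M" "y \<in> mcball_of M z (2 * R)" for x y
  proof -
    have "\<bar>g y\<bar> \<le> L * mdist M y z"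
      using g[OF that(2), of z] g0 z R by (simp add: mdist_self)
    also have "\<dots> \<le> L * (2 * R)"
      using that(2) L by (intro mult_left_mono) (auto simp: mdist_commute[of M y])
    finally have "\<bar>(\<phi> x - \<phi> y) * g y\<bar> \<le> (mdist M x y / R) * (L * (2 * R))"
      unfolding abs_mult using diff that R by (intro mult_mono) auto
    then show ?thesis using R by (simp add: mult_ac)
  qed
  have c: "cutoff M z R g v = \<phi> v * g v" if "v \<in> mspace M" for v
    using that by (simp add: cutoff_def \<phi>_def)
  have Ld: "0 \<le> L * mdist M x y" using L by simp
  consider "x \<in> mcball_of M z (2 * R)" "y \<in> mcball_of M z (2 * R)"
    | "x \<notin> mcball_of M z (2 * R)" "y \<in> mcball_of M z (2 * R)"
    | "y \<notin> mcball_of M z (2 * R)" "x \<in> mcball_of M z (2 * R)"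
    | "x \<notin> mcball_of M z (2 * R)" "y \<notin> mcball_of M z (2 * R)"
    by blast
  then have "\<bar>\<phi> x * g x - \<phi> y * g y\<bar> \<le> 3 * (L * mdist M x y)"
  proof cases
    case 1
    have "\<bar>\<phi> x * (g x - g y)\<bar> \<le> 1 * (L * mdist M x y)"
      unfolding abs_mult using g[OF 1] L by (intro mult_mono) (auto simp: \<phi>_def)
    moreover have "\<phi> x * g x - \<phi> y * g y = \<phi> x * (g x - g y) + (\<phi> x - \<phi> y) * g y"
      by (simp add: algebra_simps)
    ultimately show ?thesis using prod[OF x 1(2)] by linarith
  next
    case 2
    then show ?thesis using prod[OF x 2(2)] out[OF x 2(1)] Ld by simp
  next
    case 3
    then show ?thesis using prod[OF y 3(2)] out[OF y 3(1)] Ld by (simp add: mdist_commute[of M y])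
  next
    case 4
    then show ?thesis using out x y Ld by simp
  qed
  then show ?thesis using x y by (simp add: c)
qed

section \<open>Functionals on Lipschitz functions\<close>

lemma Lip0I:
  assumes "\<And>x y. x \<in> mspace M \<Longrightarrow> y \<in> mspace M \<Longrightarrow> \<bar>f x - f y\<bar> \<le> B * mdist M x y"
    and "f z = 0" "\<And>x. x \<notin> mspace M \<Longrightarrow> f x = 0"
  shows "f \<in> Lip0 M z"
  using assms by (auto simp: Lip0_def Lipschitz_continuous_map_def dist_real_def)

lemma subspace_Lip0: "subspace (Lip0 M z)"
proof (rule subspaceI)
  fix f g assume fg: "f \<in> Lip0 M z" "g \<in> Lip0 M z"
  show "f + g \<in> Lip0 M z"
  proof (rule Lip0I[where B = "Lip_norm M f + Lip_norm M g"])
    fix x y assume "x \<in> mspace M" "y \<in> mspace M"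
    then show "\<bar>(f + g) x - (f + g) y\<bar> \<le> (Lip_norm M f + Lip_norm M g) * mdist M x y"
      using Lip0_bound[OF fg(1), of x y] Lip0_bound[OF fg(2), of x y] by (simp add: distrib_right)
  qed (use fg in \<open>auto simp: Lip0_def\<close>)
qed (auto simp: Lip0_zero Lip0_scale)

lemma Lip0_dual_add:
  assumes "\<mu> \<in> Lip0_dual M z" "f \<in> Lip0 M z" "g \<in> Lip0 M z"
  shows "\<mu> (f + g) = \<mu> f + \<mu> g"
  using assms unfolding Lip0_dual_def by blast

lemma Lip0_dual_scale:
  assumes "\<mu> \<in> Lip0_dual M z" "f \<in> Lip0 M z"
  shows "\<mu> (c *\<^sub>R f) = c * \<mu> f"
  using assms unfolding Lip0_dual_def by blast

text \<open>A member of \<open>Lip0_dual\<close> is linear on \<open>Lip0 M z\<close> only, so the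
  induction carries along that the partial sums stay there.\<close>

lemma Lip0_dual_sum:
  assumes \<mu>: "\<mu> \<in> Lip0_dual M z" and N: "finite N" and v: "\<And>y. y \<in> N \<Longrightarrow> v y \<in> Lip0 M z"
  shows "\<mu> (\<Sum>y\<in>N. c y *\<^sub>R v y) = (\<Sum>y\<in>N. c y * \<mu> (v y))"
  using N v
proof (induction N rule: finite_induct)
  case empty
  have "\<mu> 0 = 0" using Lip0_dual_scale[OF \<mu> Lip0_zero(1), of 0] by (simp only: scale_zero_left mult_zero_left)
  then show ?case by (simp only: sum.empty)
next
  case (insert y N)
  have v: "v y \<in> Lip0 M z" "c y *\<^sub>R v y \<in> Lip0 M z" "(\<Sum>y\<in>N. c y *\<^sub>R v y) \<in> Lip0 M z"
    using insert.prems by (auto intro!: subspace_scale[OF subspace_Lip0] subspace_sum[OF subspace_Lip0])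
  have "\<mu> (\<Sum>y\<in>N. c y *\<^sub>R v y) = (\<Sum>y\<in>N. c y * \<mu> (v y))"
    using insert.IH insert.prems by blast
  then show ?case
    by (simp only: sum.insert[OF insert.hyps] Lip0_dual_add[OF \<mu> v(2,3)] Lip0_dual_scale[OF \<mu> v(1)])
qed

text \<open>Rescaling by a positive upper bound \<open>K\<close> of the Lipschitz norm avoids
  dividing by a norm that may be 0.\<close>

lemma dual_norm_bound:
  assumes \<mu>: "\<mu> \<in> Lip0_dual M z" and f: "f \<in> Lip0 M z" and K: "K > 0" "Lip_norm M f \<le> K"
  shows "\<bar>\<mu> f\<bar> \<le> K * dual_norm M z \<mu>"
proof -
  have "Lip_norm M ((1 / K) *\<^sub>R f) \<le> \<bar>1 / K\<bar> * \<bar>Lip_norm M f\<bar>" by (rule Lip0_scale(2)[OF f])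
  also have "\<dots> \<le> 1" using K Lip_norm_nonneg[OF f] by (simp add: field_simps)
  finally have "\<bar>\<mu> ((1 / K) *\<^sub>R f)\<bar> \<le> dual_norm M z \<mu>"
    using dual_norm_upper[OF \<mu> Lip0_scale(1)[OF f]] by blast
  moreover have "\<mu> ((1 / K) *\<^sub>R f) = 1 / K * \<mu> f" by (rule Lip0_dual_scale[OF \<mu> f])
  ultimately show ?thesis using K by (simp add: abs_mult field_simps)
qed

lemma dual_norm_nonneg:
  assumes "\<mu> \<in> Lip0_dual M z"
  shows "0 \<le> dual_norm M z \<mu>"
  using dual_norm_bound[OF assms Lip0_zero(1), of 1] Lip0_zero(2)[of M] by linarith

lemma dual_norm_triangle:
  assumes "\<mu> \<in> Lip0_dual M z" "\<nu> \<in> Lip0_dual M z"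
  shows "dual_norm M z (\<mu> + \<nu>) \<le> dual_norm M z \<mu> + dual_norm M z \<nu>"
proof (rule dual_norm_least)
  fix f assume "f \<in> Lip0 M z" "Lip_norm M f \<le> 1"
  then show "\<bar>(\<mu> + \<nu>) f\<bar> \<le> dual_norm M z \<mu> + dual_norm M z \<nu>"
    using dual_norm_upper[OF assms(1), of f] dual_norm_upper[OF assms(2), of f] by simp
qed

lemma dual_norm_scale:
  assumes "\<mu> \<in> Lip0_dual M z"
  shows "dual_norm M z (c *\<^sub>R \<mu>) \<le> \<bar>c\<bar> * dual_norm M z \<mu>"
proof (rule dual_norm_least)
  fix f assume "f \<in> Lip0 M z" "Lip_norm M f \<le> 1"
  then show "\<bar>(c *\<^sub>R \<mu>) f\<bar> \<le> \<bar>c\<bar> * dual_norm M z \<mu>"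
    using dual_norm_upper[OF assms, of f] by (simp add: abs_mult mult_left_mono)
qed

lemma evaluation_in_dual:
  assumes "p \<in> mspace M" "z \<in> mspace M"
  shows "evaluation M z p \<in> Lip0_dual M z"
proof -
  have "\<bar>f p\<bar> \<le> mdist M p z * Lip_norm M f" if "f \<in> Lip0 M z" for f
    using Lip0_bound[OF that assms] that by (simp add: Lip0_def mult.commute)
  then show ?thesis
    by (auto simp: Lip0_dual_def evaluation_def subspace_add[OF subspace_Lip0]
        subspace_scale[OF subspace_Lip0])
qed

section \<open>The Lipschitz-free space\<close>

lemma Lipschitz_free_iff:
  assumes "z \<in> mspace M"
  shows "\<mu> \<in> Lipschitz_free M z \<longleftrightarrow> \<mu> \<in> Lip0_dual M z \<and>
    (\<forall>e>0. \<exists>\<nu>\<in>span (evaluation M z ` mspace M). dual_norm M z (\<mu> - \<nu>) < e)"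
proof -
  interpret Metric_space "Lip0_dual M z" "norm_dist (Lip0_dual M z) (dual_norm M z)"
    by (rule Metric_space_Lip0_dual) simp
  have "span (evaluation M z ` mspace M) \<subseteq> Lip0_dual M z"
    using evaluation_in_dual[OF _ assms] by (intro span_minimal subspace_Lip0_dual) auto
  then show ?thesis
    unfolding Lipschitz_free_def norm_topology_def metric_closure_of
    by (auto simp: norm_dist_def) (metis subsetD)+
qed

lemma span_evaluation_subset:
  assumes "z \<in> mspace M"
  shows "span (evaluation M z ` mspace M) \<subseteq> Lipschitz_free M z"
proof
  fix \<nu> assume \<nu>: "\<nu> \<in> span (evaluation M z ` mspace M)"
  moreover have "span (evaluation M z ` mspace M) \<subseteq> Lip0_dual M z"
    using evaluation_in_dual[OF _ assms] by (intro span_minimal subspace_Lip0_dual) auto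
  moreover have "dual_norm M z (\<nu> - \<nu>) \<le> 0" by (rule dual_norm_least) simp
  then have "\<forall>e>0. dual_norm M z (\<nu> - \<nu>) < e" by (auto intro: le_less_trans)
  ultimately show "\<nu> \<in> Lipschitz_free M z"
    unfolding Lipschitz_free_iff[OF assms] by blast
qed

lemma subspace_Lipschitz_free:
  assumes z: "z \<in> mspace M"
  shows "subspace (Lipschitz_free M z)"
proof (rule subspaceI)
  let ?E = "span (evaluation M z ` mspace M)"
  show "0 \<in> Lipschitz_free M z" using span_evaluation_subset[OF z] span_zero by blast
  have E: "?E \<subseteq> Lip0_dual M z"
    using evaluation_in_dual[OF _ z] by (intro span_minimal subspace_Lip0_dual) auto
  note dual = subspace_add[OF subspace_Lip0_dual] subspace_scale[OF subspace_Lip0_dual]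
    subspace_diff[OF subspace_Lip0_dual]
  fix \<mu> assume \<mu>: "\<mu> \<in> Lipschitz_free M z"
  {
    fix \<nu> assume \<nu>: "\<nu> \<in> Lipschitz_free M z"
    show "\<mu> + \<nu> \<in> Lipschitz_free M z"
      unfolding Lipschitz_free_iff[OF z]
    proof (intro conjI allI impI)
      show "\<mu> + \<nu> \<in> Lip0_dual M z" using \<mu> \<nu> by (simp add: Lipschitz_free_iff[OF z] dual)
      fix e :: real assume "e > 0"
      then have "e / 2 > 0" by simp
      then obtain \<mu>' \<nu>' where *: "\<mu>' \<in> ?E" "dual_norm M z (\<mu> - \<mu>') < e / 2"
          "\<nu>' \<in> ?E" "dual_norm M z (\<nu> - \<nu>') < e / 2"
        using \<mu> \<nu> unfolding Lipschitz_free_iff[OF z] by meson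
      have "\<mu> - \<mu>' \<in> Lip0_dual M z" "\<nu> - \<nu>' \<in> Lip0_dual M z"
        using * E \<mu> \<nu> by (auto simp: Lipschitz_free_iff[OF z] intro!: dual)
      from dual_norm_triangle[OF this] have "dual_norm M z ((\<mu> + \<nu>) - (\<mu>' + \<nu>')) < e"
        using * by (simp add: algebra_simps)
      then show "\<exists>\<nu>'\<in>?E. dual_norm M z (\<mu> + \<nu> - \<nu>') < e" using * span_add by blast
    qed
  }
  fix c
  show "c *\<^sub>R \<mu> \<in> Lipschitz_free M z"
    unfolding Lipschitz_free_iff[OF z]
  proof (intro conjI allI impI)
    show "c *\<^sub>R \<mu> \<in> Lip0_dual M z" using \<mu> by (simp add: Lipschitz_free_iff[OF z] dual)
    fix e :: real assume e: "e > 0"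
    then have "e / (\<bar>c\<bar> + 1) > 0" by (simp add: add_nonneg_pos)
    then obtain \<mu>' where *: "\<mu>' \<in> ?E" "dual_norm M z (\<mu> - \<mu>') < e / (\<bar>c\<bar> + 1)"
      using \<mu> unfolding Lipschitz_free_iff[OF z] by meson
    have m: "\<mu> - \<mu>' \<in> Lip0_dual M z"
      using * E \<mu> by (auto simp: Lipschitz_free_iff[OF z] intro!: dual)
    have "dual_norm M z (c *\<^sub>R \<mu> - c *\<^sub>R \<mu>') \<le> \<bar>c\<bar> * dual_norm M z (\<mu> - \<mu>')"
      using dual_norm_scale[OF m, of c] by (simp add: scaleR_diff_right)
    also have "\<dots> \<le> (\<bar>c\<bar> + 1) * dual_norm M z (\<mu> - \<mu>')"
      using dual_norm_nonneg[OF m] by (intro mult_right_mono) auto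
    also have "\<dots> < e" using * by (simp add: field_simps add_nonneg_pos)
    finally show "\<exists>\<nu>\<in>?E. dual_norm M z (c *\<^sub>R \<mu> - \<nu>) < e" using * span_scale by blast
  qed
qed

lemma sum_fun_apply: "(\<Sum>y\<in>N. g y) x = (\<Sum>y\<in>N. g y x)" for g :: "'b \<Rightarrow> 'c \<Rightarrow> real"
  by (induction N rule: infinite_finite_induct) auto

section \<open>The finite-rank operators\<close>

text \<open>\<open>T\<close> is the preadjoint of \<open>U\<close>, averaging followed by cutoff:
  \<open>T \<mu> f = \<mu> (U f)\<close>. Hence the Lipschitz bound for \<open>U\<close> bounds
  \<open>T\<close>, and closeness of \<open>U f\<close> to \<open>f\<close> at \<open>p\<close>
  makes \<open>T\<close> nearly fix the evaluation at \<open>p\<close>. The range is spanned by the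
  evaluations at the net points.\<close>

lemma approximating_operator:
  assumes D: "doubling_constant M D" and z: "z \<in> mspace M" and \<epsilon>: "\<epsilon> > 0" and R: "R > 0"
  obtains T where "finite_rank_operator (Lipschitz_free M z) T"
    "\<And>\<mu>. \<mu> \<in> Lipschitz_free M z \<Longrightarrow> dual_norm M z (T \<mu>) \<le> 147 * (1 + ln D) * dual_norm M z \<mu>"
    "\<And>p. p \<in> mcball_of M z R \<Longrightarrow> dual_norm M z (T (evaluation M z p) - evaluation M z p) \<le> \<epsilon>"
proof -
  \<comment> \<open>The averages at \<open>p\<close> and at \<open>z\<close> are each off by at most
    \<open>4 * e\<close>.\<close>
  define e where "e = \<epsilon> / 8"
  have e: "e > 0" using \<epsilon> by (simp add: e_def)
  obtain N where N: "finite N" "N \<subseteq> mcball_of M z (2 * R)" "separated M e N"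
      and net: "\<And>x. x \<in> mcball_of M z (2 * R) \<Longrightarrow> \<exists>y\<in>N. mdist M x y < e"
    using obtain_net[OF D z e] by blast
  have NM: "N \<subseteq> mspace M" using N(2) by auto
  have D1: "0 \<le> ln D" using doubling_constant_ge_1[OF D z] by simp
  define a where "a = 3 * (1 + ln D) / e"
  have a: "0 \<le> a" using D1 e by (simp add: a_def)
  have m: "(\<Sum>y\<in>N. weight M N a y x * mdist M x y) \<le> 4 * e" if "x \<in> mcball_of M z (2 * R)" for x
    unfolding a_def using weight_moment[OF D e N(1) NM N(3) _ net[OF that]] that by simp
  have zz: "z \<in> mcball_of M z (2 * R)" using z R by (simp add: mdist_self)
  then have Ne: "N \<noteq> {}" using net by blast
  define K where "K = 147 * (1 + ln D)"
  have K: "K > 0" using D1 by (simp add: K_def add_pos_nonneg)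
  \<comment> \<open>The coefficient function of the value \<open>f y\<close> in \<open>U f\<close>.
    Subtracting the value at \<open>z\<close> restores the vanishing at the base point.\<close>
  define v where "v y = cutoff M z R (\<lambda>x. weight M N a y x - weight M N a y z)" for y
  define U where "U f = cutoff M z R (\<lambda>x. average M N a f x - average M N a f z)" for f
  define T where "T \<mu> = (\<Sum>y\<in>N. \<mu> (v y) *\<^sub>R evaluation M z y)" for \<mu>
  have v: "v y \<in> Lip0 M z" if y: "y \<in> N" for y
    unfolding v_def
  proof (rule Lip0I)
    fix x x' assume "x \<in> mspace M" "x' \<in> mspace M"
    then show "\<bar>cutoff M z R (\<lambda>x. weight M N a y x - weight M N a y z) x -
        cutoff M z R (\<lambda>x. weight M N a y x - weight M N a y z) x'\<bar> \<le> 3 * (4 * a) * mdist M x x'"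
      using weight_Lipschitz[OF N(1) NM y _ _ a] a by (intro cutoff_Lipschitz[OF z R]) auto
  qed (auto simp: cutoff_def)
  have Usum: "U f = (\<Sum>y\<in>N. f y *\<^sub>R v y)" for f
  proof
    fix x
    show "U f x = (\<Sum>y\<in>N. f y *\<^sub>R v y) x"
      unfolding sum_fun_apply U_def v_def cutoff_def average_def
      by (simp add: sum_subtractf[symmetric] sum_distrib_left algebra_simps)
  qed
  have Ubound: "Lip_norm M (U f) \<le> K * Lip_norm M f" and U0: "U f \<in> Lip0 M z" if f: "f \<in> Lip0 M z" for f
  proof -
    define l where "l = Lip_norm M f"
    have l: "0 \<le> l" unfolding l_def by (rule Lip_norm_nonneg[OF f])
    define L where "L = l * (1 + 4 * a * (4 * e))"
    have L: "0 \<le> L" using l a e by (simp add: L_def)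
    \<comment> \<open>\<open>4 * a * (4 * e)\<close> is \<open>48 * (1 + ln D)\<close>; adding 1
      gives at most \<open>49 * (1 + ln D)\<close>, and the cutoff triples this to 147.\<close>
    have "3 * L = 3 * l * (1 + 48 * (1 + ln D))" using e by (simp add: L_def a_def)
    also have "\<dots> \<le> K * l" using mult_nonneg_nonneg[OF l D1] l by (simp add: K_def algebra_simps)
    finally have LK: "3 * L \<le> K * l" .
    have *: "\<bar>U f x - U f y\<bar> \<le> 3 * L * mdist M x y" if xy: "x \<in> mspace M" "y \<in> mspace M" for x y
      unfolding U_def
    proof (rule cutoff_Lipschitz[OF z R L _ _ xy])
      fix x y assume xy: "x \<in> mcball_of M z (2 * R)" "y \<in> mcball_of M z (2 * R)"
      have "\<bar>average M N a f x - average M N a f y\<bar> \<le> L * mdist M x y"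
        unfolding L_def using m[OF xy(1)] m[OF xy(2)] xy a l Lip0_bound[OF f]
        by (intro average_Lipschitz[OF N(1) Ne NM]) (auto simp: l_def)
      then show "\<bar>average M N a f x - average M N a f z - (average M N a f y - average M N a f z)\<bar>
          \<le> L * mdist M x y"
        by simp
    qed simp
    have "\<bar>U f x - U f y\<bar> \<le> K * l * mdist M x y" if xy: "x \<in> mspace M" "y \<in> mspace M" for x y
      using *[OF xy] mult_right_mono[OF LK mdist_nonneg[of M x y]] by linarith
    then show "Lip_norm M (U f) \<le> K * Lip_norm M f"
      using K l unfolding l_def by (intro Lip_norm_le) auto
    show "U f \<in> Lip0 M z" using * by (rule Lip0I) (auto simp: U_def cutoff_def)
  qed
  have TU: "T \<mu> f = \<mu> (U f)" if \<mu>: "\<mu> \<in> Lip0_dual M z" and f: "f \<in> Lip0 M z" for \<mu> f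
  proof -
    have "T \<mu> f = (\<Sum>y\<in>N. f y * \<mu> (v y))"
      using f by (simp add: T_def sum_fun_apply evaluation_def mult.commute)
    also have "\<dots> = \<mu> (U f)"
      unfolding Usum by (rule Lip0_dual_sum[OF \<mu> N(1), symmetric]) (rule v)
    finally show ?thesis .
  qed
  have EN: "evaluation M z ` N \<subseteq> Lipschitz_free M z"
    using span_evaluation_subset[OF z] NM by (auto intro!: span_base subsetD[OF span_evaluation_subset[OF z]])
  have span: "T \<mu> \<in> span (evaluation M z ` N)" for \<mu>
    unfolding T_def by (intro span_sum span_scale span_base imageI)
  show ?thesis
  proof
    show "finite_rank_operator (Lipschitz_free M z) T"
      unfolding finite_rank_operator_def
    proof (intro conjI ballI allI)
      show "T \<in> Lipschitz_free M z \<rightarrow> Lipschitz_free M z"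
        using span span_minimal[OF EN subspace_Lipschitz_free[OF z]] by auto
      show "T (\<mu> + \<nu>) = T \<mu> + T \<nu>" for \<mu> \<nu> by (simp add: T_def scaleR_add_left sum.distrib)
      show "T (c *\<^sub>R \<mu>) = c *\<^sub>R T \<mu>" for c \<mu> by (simp add: T_def scaleR_sum_right)
      show "\<exists>B. finite B \<and> T ` Lipschitz_free M z \<subseteq> span B"
        using N(1) span by (intro exI[of _ "evaluation M z ` N"]) auto
    qed
  next
    fix \<mu> assume "\<mu> \<in> Lipschitz_free M z"
    then have \<mu>: "\<mu> \<in> Lip0_dual M z" using Lipschitz_free_iff[OF z] by blast
    have "dual_norm M z (T \<mu>) \<le> K * dual_norm M z \<mu>"
    proof (rule dual_norm_least)
      fix f assume f: "f \<in> Lip0 M z" "Lip_norm M f \<le> 1"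
      have "Lip_norm M (U f) \<le> K"
        using Ubound[OF f(1)] mult_left_mono[OF f(2), of K] K by linarith
      then show "\<bar>T \<mu> f\<bar> \<le> K * dual_norm M z \<mu>"
        unfolding TU[OF \<mu> f(1)] by (rule dual_norm_bound[OF \<mu> U0[OF f(1)] K])
    qed
    then show "dual_norm M z (T \<mu>) \<le> 147 * (1 + ln D) * dual_norm M z \<mu>" by (simp add: K_def)
  next
    fix p assume p: "p \<in> mcball_of M z R"
    then have pM: "p \<in> mspace M" by simp
    show "dual_norm M z (T (evaluation M z p) - evaluation M z p) \<le> \<epsilon>"
    proof (rule dual_norm_least)
      fix f assume f: "f \<in> Lip0 M z" "Lip_norm M f \<le> 1"
      have approx: "\<bar>average M N a f x - f x\<bar> \<le> 1 * (4 * e)" if x: "x \<in> mcball_of M z (2 * R)" for x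
      proof (rule average_approx[OF N(1) Ne NM _ _ m[OF x]])
        fix y assume "y \<in> N"
        then have "\<bar>f y - f x\<bar> \<le> Lip_norm M f * mdist M y x"
          using NM x by (intro Lip0_bound[OF f(1)]) auto
        also have "\<dots> \<le> 1 * mdist M y x" using f(2) by (intro mult_right_mono) auto
        finally show "\<bar>f y - f x\<bar> \<le> 1 * mdist M x y" by (simp add: mdist_commute)
      qed (use x in auto)
      have "U f p = average M N a f p - average M N a f z"
        using p R by (simp add: U_def cutoff_def field_simps)
      moreover have "f z = 0" using f(1) by (simp add: Lip0_def)
      moreover have "p \<in> mcball_of M z (2 * R)" using p R by simp
      ultimately have "\<bar>U f p - f p\<bar> \<le> \<epsilon>"
        using approx[of p] approx[OF zz] unfolding e_def by linarith
      then show "\<bar>(T (evaluation M z p) - evaluation M z p) f\<bar> \<le> \<epsilon>"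
        using TU[OF evaluation_in_dual[OF pM z] f(1)] f(1) U0[OF f(1)] by (simp add: evaluation_def)
    qed
  qed
qed

section \<open>The bounded approximation property on finite sets\<close>

lemma norm_triangle:
  assumes "Metric_space Z (norm_dist Z nrm)" "x \<in> Z" "y \<in> Z" "w \<in> Z"
  shows "nrm (x - y) \<le> nrm (x - w) + nrm (w - y)"
  using Metric_space.triangle[OF assms(1), of x w y] assms(2-4) by (simp add: norm_dist_def)

lemma norm_commute:
  assumes "Metric_space Z (norm_dist Z nrm)" "x \<in> Z" "y \<in> Z"
  shows "nrm (x - y) = nrm (y - x)"
  using Metric_space.commute[OF assms(1), of x y] assms(2,3) by (simp add: norm_dist_def)

text \<open>Compact sets are totally bounded, and the common norm bound \<open>K\<close> spreads an
  approximation on finitely many points of a dense set to everything near them.\<close>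

lemma bounded_approximation_propertyI:
  assumes Z: "subspace Z" and ms: "Metric_space Z (norm_dist Z nrm)" and K: "1 \<le> K"
    and S: "S \<subseteq> Z" and dense: "\<And>x e. x \<in> Z \<Longrightarrow> e > 0 \<Longrightarrow> \<exists>s\<in>S. nrm (x - s) < e"
    and fin: "\<And>\<epsilon> F. \<epsilon> > 0 \<Longrightarrow> finite F \<Longrightarrow> F \<subseteq> S \<Longrightarrow> \<exists>T. finite_rank_operator Z T \<and>
      (\<forall>x\<in>Z. nrm (T x) \<le> K * nrm x) \<and> (\<forall>x\<in>F. nrm (T x - x) \<le> \<epsilon>)"
  shows "bounded_approximation_property K Z nrm"
  unfolding bounded_approximation_property_def
proof (intro conjI K allI impI)
  interpret Metric_space Z "norm_dist Z nrm" by (rule ms)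
  fix \<epsilon> :: real and L assume \<epsilon>: "\<epsilon> > 0" and L: "compactin (norm_topology Z nrm) L"
  \<comment> \<open>A point of \<open>L\<close> is within \<open>2 * \<eta>\<close> of some chosen
    point of \<open>S\<close>: this costs \<open>2 * K * \<eta>\<close> after applying
    \<open>T\<close> and \<open>2 * \<eta>\<close> before, plus \<open>\<eta>\<close> for the error
    at that point.\<close>
  define \<eta> where "\<eta> = \<epsilon> / (2 * K + 3)"
  have \<eta>: "\<eta> > 0" "(2 * K + 3) * \<eta> = \<epsilon>" using \<epsilon> K by (auto simp: \<eta>_def)
  have "mtotally_bounded L"
    by (rule compactin_imp_mtotally_bounded[OF L[unfolded norm_topology_def]])
  from this[unfolded mtotally_bounded_def, rule_format, OF \<eta>(1)]
  obtain G where G: "finite G" "G \<subseteq> L" "L \<subseteq> (\<Union>x\<in>G. mball x \<eta>)" by blast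
  have LZ: "L \<subseteq> Z" using compactin_subset_topspace[OF L] by (simp add: norm_topology_def)
  have "\<forall>g\<in>G. \<exists>s\<in>S. nrm (g - s) < \<eta>" using dense G(2) LZ \<eta>(1) by blast
  then obtain s where s: "\<And>g. g \<in> G \<Longrightarrow> s g \<in> S \<and> nrm (g - s g) < \<eta>" by metis
  obtain T where T: "finite_rank_operator Z T" "\<And>x. x \<in> Z \<Longrightarrow> nrm (T x) \<le> K * nrm x"
      "\<And>x. x \<in> s ` G \<Longrightarrow> nrm (T x - x) \<le> \<eta>"
    using fin[OF \<eta>(1), of "s ` G"] G(1) s by blast
  have "nrm (T x - x) \<le> \<epsilon>" if x: "x \<in> L" for x
  proof -
    obtain g where g: "g \<in> G" "x \<in> mball g \<eta>" using G(3) x by blast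
    have Zs: "x \<in> Z" "g \<in> Z" "s g \<in> Z" using x g G LZ s S by auto
    then have TZ: "T x \<in> Z" "T (s g) \<in> Z" using T(1) by (auto simp: finite_rank_operator_def)
    have "nrm (g - x) < \<eta>" using g(2) Zs by (simp add: norm_dist_def)
    then have xs: "nrm (x - s g) \<le> 2 * \<eta>"
      using norm_triangle[OF ms Zs(1,3,2)] norm_commute[OF ms Zs(1,2)] s[OF g(1)] by linarith
    have "x - s g \<in> Z" using Zs by (intro subspace_diff[OF Z])
    moreover have "T x = T (x - s g) + T (s g)"
    proof -
      have "T ((x - s g) + s g) = T (x - s g) + T (s g)"
        using T(1) Zs \<open>x - s g \<in> Z\<close> unfolding finite_rank_operator_def by blast
      then show ?thesis by (simp only: diff_add_cancel)
    qed
    ultimately have "nrm (T x - T (s g)) \<le> K * nrm (x - s g)" using T(2)[of "x - s g"] by simp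
    also have "\<dots> \<le> K * (2 * \<eta>)" using xs K by (intro mult_left_mono) auto
    finally have "nrm (T x - T (s g)) \<le> K * (2 * \<eta>)" .
    moreover have "nrm (T x - x) \<le> nrm (T x - T (s g)) + nrm (T (s g) - x)"
      by (rule norm_triangle[OF ms TZ(1) Zs(1) TZ(2)])
    moreover have "nrm (T (s g) - x) \<le> nrm (T (s g) - s g) + nrm (s g - x)"
      by (rule norm_triangle[OF ms TZ(2) Zs(1,3)])
    moreover have "nrm (T (s g) - s g) \<le> \<eta>" using T(3) g(1) by blast
    moreover have "nrm (s g - x) = nrm (x - s g)" by (rule norm_commute[OF ms Zs(3,1)])
    ultimately show ?thesis using xs \<eta>(2) by (simp add: algebra_simps)
  qed
  then show "\<exists>T. finite_rank_operator Z T \<and> (\<forall>x\<in>Z. nrm (T x) \<le> K * nrm x) \<and>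
      (\<forall>x\<in>L. nrm (T x - x) \<le> \<epsilon>)"
    using T(1,2) by blast
qed

text \<open>Finite sets are compact. With \<open>bounded_approximation_propertyI\<close> this
  reduces the transfer along isometries to finite sets.\<close>

lemma bounded_approximation_property_finite:
  assumes "bounded_approximation_property K Z nrm" "Metric_space Z (norm_dist Z nrm)"
    and "\<epsilon> > 0" "finite F" "F \<subseteq> Z"
  obtains T where "finite_rank_operator Z T" "\<And>x. x \<in> Z \<Longrightarrow> nrm (T x) \<le> K * nrm x"
    "\<And>x. x \<in> F \<Longrightarrow> nrm (T x - x) \<le> \<epsilon>"
proof -
  have "compactin (norm_topology Z nrm) F"
    using assms(4,5) unfolding norm_topology_def
    by (intro finite_imp_compactin) (simp_all add: Metric_space.topspace_mtopology[OF assms(2)])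
  then have "\<exists>T. finite_rank_operator Z T \<and> (\<forall>x\<in>Z. nrm (T x) \<le> K * nrm x) \<and>
      (\<forall>x\<in>F. nrm (T x - x) \<le> \<epsilon>)"
    using assms(1,3) unfolding bounded_approximation_property_def by (elim conjE allE impE)
  then show ?thesis using that by blast
qed

lemma Metric_space_Lipschitz_free:
  assumes "z \<in> mspace M"
  shows "Metric_space (Lipschitz_free M z) (norm_dist (Lipschitz_free M z) (dual_norm M z))"
proof (rule Metric_space_Lip0_dual)
  show "Lipschitz_free M z \<subseteq> Lip0_dual M z" using Lipschitz_free_iff[OF assms] by blast
qed

text \<open>The number \<open>\<rho>\<close> grows by \<open>\<bar>c\<bar>\<close> and by the
  distance from \<open>z\<close> with each summand, so it serves both as a radius capturing all
  evaluation points involved and as the factor of the error. It is chosen before the operator, which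
  is built afterwards from a radius and an accuracy.\<close>

lemma span_approximation:
  assumes z: "z \<in> mspace M" and \<nu>: "\<nu> \<in> span (evaluation M z ` mspace M)"
  shows "\<exists>\<rho>>0. \<forall>T \<epsilon> R. finite_rank_operator (Lipschitz_free M z) T \<longrightarrow> \<rho> \<le> R \<longrightarrow> 0 \<le> \<epsilon> \<longrightarrow>
    (\<forall>p\<in>mcball_of M z R. dual_norm M z (T (evaluation M z p) - evaluation M z p) \<le> \<epsilon>) \<longrightarrow>
    dual_norm M z (T \<nu> - \<nu>) \<le> \<rho> * \<epsilon>"
proof -
  let ?F = "Lipschitz_free M z" and ?N = "dual_norm M z"
  let ?P = "\<lambda>\<nu>. \<exists>\<rho>>0. \<forall>T \<epsilon> R. finite_rank_operator ?F T \<longrightarrow> \<rho> \<le> R \<longrightarrow> 0 \<le> \<epsilon> \<longrightarrow>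
    (\<forall>p\<in>mcball_of M z R. ?N (T (evaluation M z p) - evaluation M z p) \<le> \<epsilon>) \<longrightarrow>
    ?N (T \<nu> - \<nu>) \<le> \<rho> * \<epsilon>"
  have sub: "subspace ?F" by (rule subspace_Lipschitz_free[OF z])
  have dual: "\<mu> \<in> Lip0_dual M z" if "\<mu> \<in> ?F" for \<mu> using that Lipschitz_free_iff[OF z] by blast
  have "\<nu> \<in> ?F \<and> ?P \<nu>"
    using \<nu>
  proof (induction rule: span_induct_alt)
    case base
    have "0 \<in> ?F" by (rule subspace_0[OF sub])
    have "T 0 = 0" if "finite_rank_operator ?F T" for T
    proof -
      have "T (0 *\<^sub>R 0) = 0 *\<^sub>R T 0"
        using that \<open>0 \<in> ?F\<close> unfolding finite_rank_operator_def by blast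
      then show ?thesis by (simp only: scale_zero_left)
    qed
    moreover have "?N 0 \<le> 0" by (rule dual_norm_least) simp
    ultimately have "?N (T 0 - 0) \<le> 1 * \<epsilon>"
      if "finite_rank_operator ?F T" "0 \<le> \<epsilon>" for T \<epsilon>
      using that by (simp only: diff_zero mult_1)
    then show ?case using zero_less_one \<open>0 \<in> ?F\<close> by blast
  next
    case (step c x \<nu>)
    then obtain p where p: "p \<in> mspace M" "x = evaluation M z p" by blast
    from step have \<nu>F: "\<nu> \<in> ?F" by blast
    from step obtain \<rho> where \<rho>: "\<rho> > 0" "\<And>T \<epsilon> R. finite_rank_operator ?F T \<Longrightarrow> \<rho> \<le> R \<Longrightarrow> 0 \<le> \<epsilon> \<Longrightarrow>
        (\<forall>p\<in>mcball_of M z R. ?N (T (evaluation M z p) - evaluation M z p) \<le> \<epsilon>) \<Longrightarrow>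
        ?N (T \<nu> - \<nu>) \<le> \<rho> * \<epsilon>"
      by blast
    have xF: "x \<in> ?F" using span_evaluation_subset[OF z] p span_base by blast
    have "?P (c *\<^sub>R x + \<nu>)"
    proof (intro exI[of _ "\<rho> + \<bar>c\<bar> + mdist M z p"] conjI allI impI)
      show "0 < \<rho> + \<bar>c\<bar> + mdist M z p" using \<rho>(1) mdist_nonneg[of M z p] by linarith
      fix T \<epsilon> R assume T: "finite_rank_operator ?F T" and R: "\<rho> + \<bar>c\<bar> + mdist M z p \<le> R" and \<epsilon>: "0 \<le> \<epsilon>"
        and b: "\<forall>p\<in>mcball_of M z R. ?N (T (evaluation M z p) - evaluation M z p) \<le> \<epsilon>"
      have TF: "T x \<in> ?F" "T \<nu> \<in> ?F" using T xF \<nu>F by (auto simp: finite_rank_operator_def)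
      have "T (c *\<^sub>R x + \<nu>) = T (c *\<^sub>R x) + T \<nu>"
        using T \<nu>F subspace_scale[OF sub xF] unfolding finite_rank_operator_def by blast
      moreover have "T (c *\<^sub>R x) = c *\<^sub>R T x" using T xF unfolding finite_rank_operator_def by blast
      ultimately have eq: "T (c *\<^sub>R x + \<nu>) - (c *\<^sub>R x + \<nu>) = c *\<^sub>R (T x - x) + (T \<nu> - \<nu>)"
        by (simp only: scaleR_diff_right) (simp only: algebra_simps)
      have d: "T x - x \<in> Lip0_dual M z" "T \<nu> - \<nu> \<in> Lip0_dual M z"
        using TF xF \<nu>F by (auto intro!: dual subspace_diff[OF sub])
      have "?N (c *\<^sub>R (T x - x) + (T \<nu> - \<nu>)) \<le> ?N (c *\<^sub>R (T x - x)) + ?N (T \<nu> - \<nu>)"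
        by (rule dual_norm_triangle[OF subspace_scale[OF subspace_Lip0_dual d(1)] d(2)])
      moreover have "?N (c *\<^sub>R (T x - x)) \<le> \<bar>c\<bar> * ?N (T x - x)" by (rule dual_norm_scale[OF d(1)])
      moreover have "?N (T x - x) \<le> \<epsilon>"
      proof -
        have "p \<in> mcball_of M z R" using p(1) z R \<rho>(1) by simp
        then show ?thesis using b p(2) by blast
      qed
      then have "\<bar>c\<bar> * ?N (T x - x) \<le> \<bar>c\<bar> * \<epsilon>" by (rule mult_left_mono) simp
      moreover have "\<rho> \<le> R" using R mdist_nonneg[of M z p] by linarith
      then have "?N (T \<nu> - \<nu>) \<le> \<rho> * \<epsilon>" using \<rho>(2)[OF T _ \<epsilon> b] by blast
      moreover have "0 \<le> mdist M z p * \<epsilon>" using \<epsilon> by simp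
      ultimately have "?N (c *\<^sub>R (T x - x) + (T \<nu> - \<nu>)) \<le> (\<rho> + \<bar>c\<bar> + mdist M z p) * \<epsilon>"
        unfolding distrib_right by linarith
      then show "?N (T (c *\<^sub>R x + \<nu>) - (c *\<^sub>R x + \<nu>)) \<le> (\<rho> + \<bar>c\<bar> + mdist M z p) * \<epsilon>"
        by (simp only: eq)
    qed
    moreover have "c *\<^sub>R x + \<nu> \<in> ?F"
      by (rule subspace_add[OF sub subspace_scale[OF sub xF] \<nu>F])
    ultimately show ?case by blast
  qed
  then show ?thesis by blast
qed

theorem Lipschitz_free_approximation:
  assumes z: "z \<in> mspace M" and D: "doubling_constant M D"
  shows "bounded_approximation_property (147 * (1 + ln D)) (Lipschitz_free M z) (dual_norm M z)"
proof (rule bounded_approximation_propertyI[OF subspace_Lipschitz_free[OF z]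
    Metric_space_Lipschitz_free[OF z] _ span_evaluation_subset[OF z]])
  let ?F = "Lipschitz_free M z" and ?N = "dual_norm M z"
  show "1 \<le> 147 * (1 + ln D)" using doubling_constant_ge_1[OF D z] ln_ge_zero[of D] by simp
  show "\<exists>s\<in>span (evaluation M z ` mspace M). ?N (x - s) < e" if "x \<in> ?F" "e > 0" for x e
    using that Lipschitz_free_iff[OF z] by blast
  fix \<epsilon> :: real and G assume \<epsilon>: "\<epsilon> > 0" and G: "finite G" "G \<subseteq> span (evaluation M z ` mspace M)"
  have "\<forall>\<nu>\<in>G. \<exists>\<rho>>0. \<forall>T \<epsilon> R. finite_rank_operator ?F T \<longrightarrow> \<rho> \<le> R \<longrightarrow> 0 \<le> \<epsilon> \<longrightarrow>
    (\<forall>p\<in>mcball_of M z R. ?N (T (evaluation M z p) - evaluation M z p) \<le> \<epsilon>) \<longrightarrow>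
    ?N (T \<nu> - \<nu>) \<le> \<rho> * \<epsilon>"
    using span_approximation[OF z] G(2) by blast
  then obtain \<rho> where \<rho>: "\<And>\<nu>. \<nu> \<in> G \<Longrightarrow> \<rho> \<nu> > 0"
    "\<And>\<nu> T \<epsilon> R. \<nu> \<in> G \<Longrightarrow> finite_rank_operator ?F T \<Longrightarrow> \<rho> \<nu> \<le> R \<Longrightarrow> 0 \<le> \<epsilon> \<Longrightarrow>
      (\<forall>p\<in>mcball_of M z R. ?N (T (evaluation M z p) - evaluation M z p) \<le> \<epsilon>) \<Longrightarrow>
      ?N (T \<nu> - \<nu>) \<le> \<rho> \<nu> * \<epsilon>"
    by metis
  \<comment> \<open>Dominates every \<open>\<rho> \<nu>\<close>, both as a radius and, with accuracy
    \<open>\<epsilon> / R\<close>, as an error factor.\<close>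
  define R where "R = 1 + sum \<rho> G"
  have R: "R > 0" unfolding R_def using \<rho>(1) by (simp add: add_pos_nonneg sum_nonneg less_imp_le)
  have le: "\<rho> \<nu> \<le> R" if "\<nu> \<in> G" for \<nu>
    unfolding R_def using member_le_sum[of \<nu> G \<rho>] that G(1) \<rho>(1) by (force intro: less_imp_le)
  have "\<epsilon> / R > 0" using \<epsilon> R by simp
  from approximating_operator[OF D z this R] obtain T where T: "finite_rank_operator ?F T"
    "\<And>\<mu>. \<mu> \<in> ?F \<Longrightarrow> ?N (T \<mu>) \<le> 147 * (1 + ln D) * ?N \<mu>"
    "\<And>p. p \<in> mcball_of M z R \<Longrightarrow> ?N (T (evaluation M z p) - evaluation M z p) \<le> \<epsilon> / R"
    by blast
  have "?N (T \<nu> - \<nu>) \<le> \<epsilon>" if "\<nu> \<in> G" for \<nu>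
  proof -
    have "?N (T \<nu> - \<nu>) \<le> \<rho> \<nu> * (\<epsilon> / R)"
    proof (rule \<rho>(2)[OF that T(1) le[OF that]])
      show "0 \<le> \<epsilon> / R" using \<open>\<epsilon> / R > 0\<close> by simp
    qed (use T(3) in blast)
    also have "\<dots> \<le> R * (\<epsilon> / R)" using le[OF that] \<epsilon> R by (intro mult_right_mono) auto
    finally show ?thesis using R by simp
  qed
  then show "\<exists>T. finite_rank_operator ?F T \<and> (\<forall>x\<in>?F. ?N (T x) \<le> 147 * (1 + ln D) * ?N x) \<and>
      (\<forall>x\<in>G. ?N (T x - x) \<le> \<epsilon>)"
    using T(1,2) by blast
qed

section \<open>Isometric copies\<close>

text \<open>An isometric embedding that respects base points. A bijective isometry is treated as two
  instances, \<open>g\<close> and \<open>h\<close>, with \<open>g (h x) = x\<close>.\<close>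

locale pointed_isometry =
  fixes N :: "'b metric" and w :: 'b and M :: "'a metric" and z :: 'a and g :: "'b \<Rightarrow> 'a"
  assumes w: "w \<in> mspace N" and g_in: "x \<in> mspace N \<Longrightarrow> g x \<in> mspace M"
    and g_dist: "x \<in> mspace N \<Longrightarrow> y \<in> mspace N \<Longrightarrow> mdist M (g x) (g y) = mdist N x y"
    and g_base: "g w = z"
begin

definition pullback :: "('a \<Rightarrow> real) \<Rightarrow> 'b \<Rightarrow> real"
  where "pullback f x = (if x \<in> mspace N then f (g x) else 0)"

text \<open>The adjoint of \<open>pullback\<close>, that is, the linearization of \<open>g\<close>
  between the free spaces.\<close>

definition pushforward :: "(('b \<Rightarrow> real) \<Rightarrow> real) \<Rightarrow> ('a \<Rightarrow> real) \<Rightarrow> real"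
  where "pushforward \<mu> f = (if f \<in> Lip0 M z then \<mu> (pullback f) else 0)"

lemma z: "z \<in> mspace M"
  using g_in[OF w] g_base by simp

lemma pullback:
  assumes "f \<in> Lip0 M z"
  shows "pullback f \<in> Lip0 N w" "Lip_norm N (pullback f) \<le> Lip_norm M f"
proof -
  have b: "\<bar>pullback f x - pullback f y\<bar> \<le> Lip_norm M f * mdist N x y"
    if "x \<in> mspace N" "y \<in> mspace N" for x y
    using that Lip0_bound[OF assms g_in g_in, of x y] by (simp add: pullback_def g_dist)
  then show "pullback f \<in> Lip0 N w"
    using assms w by (intro Lip0I[where B = "Lip_norm M f"]) (auto simp: pullback_def g_base Lip0_def)
  show "Lip_norm N (pullback f) \<le> Lip_norm M f"
    using b by (rule Lip_norm_le[OF Lip_norm_nonneg[OF assms]])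
qed

text \<open>Being defined pointwise, the map is linear on the whole function type and not just on
  the dual, so images of spans can be computed directly.\<close>

lemma linear_pushforward: "linear pushforward"
  by (rule linearI) (auto simp: pushforward_def fun_eq_iff)

lemma pushforward_in_dual:
  assumes \<mu>: "\<mu> \<in> Lip0_dual N w"
  shows "pushforward \<mu> \<in> Lip0_dual M z"
  unfolding Lip0_dual_def
proof (intro CollectI conjI ballI allI impI)
  fix f g assume fg: "f \<in> Lip0 M z" "g \<in> Lip0 M z"
  have "pullback (f + g) = pullback f + pullback g" by (auto simp: pullback_def fun_eq_iff)
  then show "pushforward \<mu> (f + g) = pushforward \<mu> f + pushforward \<mu> g"
    using fg subspace_add[OF subspace_Lip0 fg]
    by (simp only: pushforward_def if_True Lip0_dual_add[OF \<mu> pullback(1)[OF fg(1)] pullback(1)[OF fg(2)]])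
next
  fix c f assume f: "f \<in> Lip0 M z"
  have "pullback (c *\<^sub>R f) = c *\<^sub>R pullback f" by (auto simp: pullback_def fun_eq_iff)
  then show "pushforward \<mu> (c *\<^sub>R f) = c * pushforward \<mu> f"
    using f subspace_scale[OF subspace_Lip0 f]
    by (simp only: pushforward_def if_True Lip0_dual_scale[OF \<mu> pullback(1)[OF f]])
next
  obtain B where B: "\<And>f. f \<in> Lip0 N w \<Longrightarrow> \<bar>\<mu> f\<bar> \<le> B * Lip_norm N f"
    using \<mu> unfolding Lip0_dual_def by blast
  have "\<bar>pushforward \<mu> f\<bar> \<le> \<bar>B\<bar> * Lip_norm M f" if f: "f \<in> Lip0 M z" for f
  proof -
    have "\<bar>\<mu> (pullback f)\<bar> \<le> \<bar>B\<bar> * Lip_norm N (pullback f)"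
      using B[OF pullback(1)[OF f]] mult_right_mono[OF abs_ge_self[of B] Lip_norm_nonneg[OF pullback(1)[OF f]]]
      by linarith
    also have "\<dots> \<le> \<bar>B\<bar> * Lip_norm M f" using pullback(2)[OF f] by (intro mult_left_mono) auto
    finally show ?thesis using f by (simp add: pushforward_def)
  qed
  then show "\<exists>B. \<forall>f\<in>Lip0 M z. \<bar>pushforward \<mu> f\<bar> \<le> B * Lip_norm M f" by blast
qed (simp add: pushforward_def)

lemma dual_norm_pushforward:
  assumes "\<mu> \<in> Lip0_dual N w"
  shows "dual_norm M z (pushforward \<mu>) \<le> dual_norm N w \<mu>"
proof (rule dual_norm_least)
  fix f assume f: "f \<in> Lip0 M z" "Lip_norm M f \<le> 1"
  then have "\<bar>\<mu> (pullback f)\<bar> \<le> dual_norm N w \<mu>"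
    using pullback[OF f(1)] by (intro dual_norm_upper[OF assms]) auto
  then show "\<bar>pushforward \<mu> f\<bar> \<le> dual_norm N w \<mu>" using f by (simp add: pushforward_def)
qed

lemma pushforward_evaluation:
  assumes "x \<in> mspace N"
  shows "pushforward (evaluation N w x) = evaluation M z (g x)"
proof
  fix f
  show "pushforward (evaluation N w x) f = evaluation M z (g x) f"
    using assms pullback(1)[of f] by (simp add: pushforward_def evaluation_def pullback_def[of f x])
qed

text \<open>A linear map that does not increase norms and sends evaluations to evaluations respects
  the closures of their spans.\<close>

lemma pushforward_Lipschitz_free:
  assumes \<mu>: "\<mu> \<in> Lipschitz_free N w"
  shows "pushforward \<mu> \<in> Lipschitz_free M z"
  unfolding Lipschitz_free_iff[OF z]
proof (intro conjI allI impI)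
  have \<mu>': "\<mu> \<in> Lip0_dual N w" using \<mu> Lipschitz_free_iff[OF w] by blast
  then show "pushforward \<mu> \<in> Lip0_dual M z" by (rule pushforward_in_dual)
  fix e :: real assume "e > 0"
  then obtain \<nu> where \<nu>: "\<nu> \<in> span (evaluation N w ` mspace N)" "dual_norm N w (\<mu> - \<nu>) < e"
    using \<mu> Lipschitz_free_iff[OF w] by blast
  have "\<nu> \<in> Lip0_dual N w"
    using \<nu>(1) span_evaluation_subset[OF w] Lipschitz_free_iff[OF w] by blast
  then have "\<mu> - \<nu> \<in> Lip0_dual N w" by (rule subspace_diff[OF subspace_Lip0_dual \<mu>'])
  from dual_norm_pushforward[OF this] have "dual_norm M z (pushforward \<mu> - pushforward \<nu>) < e"
    using \<nu>(2) unfolding linear_diff[OF linear_pushforward] by linarith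
  moreover have "pushforward \<nu> \<in> span (pushforward ` evaluation N w ` mspace N)"
    using \<nu>(1) unfolding linear_span_image[OF linear_pushforward] by blast
  moreover have "pushforward ` evaluation N w ` mspace N \<subseteq> evaluation M z ` mspace M"
    using g_in by (auto simp: pushforward_evaluation)
  ultimately show "\<exists>\<nu>\<in>span (evaluation M z ` mspace M). dual_norm M z (pushforward \<mu> - \<nu>) < e"
    using span_mono by blast
qed

end

text \<open>Pulling back along \<open>g\<close> and then \<open>h\<close> returns \<open>f\<close>
  on \<open>mspace M\<close>; off \<open>mspace M\<close>, and for functionals off
  \<open>Lip0\<close>, extension by 0 gives equality.\<close>

lemma pushforward_inverse:
  assumes g: "pointed_isometry N w M z g" and h: "pointed_isometry M z N w h"
    and gh: "\<forall>x\<in>mspace M. g (h x) = x" and \<mu>: "\<mu> \<in> Lip0_dual M z"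
  shows "pointed_isometry.pushforward N M z g (pointed_isometry.pushforward M N w h \<mu>) = \<mu>"
proof
  interpret g: pointed_isometry N w M z g by (rule g)
  interpret h: pointed_isometry M z N w h by (rule h)
  fix f
  show "g.pushforward (h.pushforward \<mu>) f = \<mu> f"
  proof (cases "f \<in> Lip0 M z")
    case True
    have "h.pullback (g.pullback f) = f"
      using True h.g_in gh by (auto simp: fun_eq_iff h.pullback_def g.pullback_def Lip0_def)
    then show ?thesis using True g.pullback(1)[OF True] by (simp add: g.pushforward_def h.pushforward_def)
  next
    case False
    then show ?thesis using \<mu> by (simp add: g.pushforward_def Lip0_dual_def)
  qed
qed

text \<open>Operators are conjugated by the two pushforwards. Neither increases norms, so both
  \<open>K\<close> and the error bound survive unchanged.\<close>

lemma bounded_approximation_property_isometry: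
  assumes g: "pointed_isometry N w M z g" and h: "pointed_isometry M z N w h"
    and gh: "\<forall>x\<in>mspace M. g (h x) = x"
    and bap: "bounded_approximation_property K (Lipschitz_free N w) (dual_norm N w)"
  shows "bounded_approximation_property K (Lipschitz_free M z) (dual_norm M z)"
proof -
  interpret g: pointed_isometry N w M z g by (rule g)
  interpret h: pointed_isometry M z N w h by (rule h)
  let ?F = "Lipschitz_free M z" and ?G = "Lipschitz_free N w"
  have F: "\<mu> \<in> Lip0_dual M z" if "\<mu> \<in> ?F" for \<mu> using that Lipschitz_free_iff[OF g.z] by blast
  have G: "\<mu> \<in> Lip0_dual N w" if "\<mu> \<in> ?G" for \<mu> using that Lipschitz_free_iff[OF h.z] by blast
  note inv = pushforward_inverse[OF g h gh]
  show ?thesis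
  proof (rule bounded_approximation_propertyI[OF subspace_Lipschitz_free[OF g.z]
      Metric_space_Lipschitz_free[OF g.z] _ subset_refl])
    show K: "1 \<le> K" using bap by (simp add: bounded_approximation_property_def)
    fix \<mu> and e :: real assume "\<mu> \<in> ?F" "e > 0"
    moreover have "dual_norm M z (\<mu> - \<mu>) \<le> 0" by (rule dual_norm_least) simp
    ultimately show "\<exists>\<nu>\<in>?F. dual_norm M z (\<mu> - \<nu>) < e" by (meson le_less_trans)
  next
    fix \<epsilon> :: real and A assume A: "\<epsilon> > 0" "finite A" "A \<subseteq> ?F"
    have "finite (h.pushforward ` A)" "h.pushforward ` A \<subseteq> ?G"
      using A h.pushforward_Lipschitz_free by auto
    from bounded_approximation_property_finite[OF bap Metric_space_Lipschitz_free[OF h.z] A(1) this]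
    obtain T where T: "finite_rank_operator ?G T"
      "\<And>\<mu>. \<mu> \<in> ?G \<Longrightarrow> dual_norm N w (T \<mu>) \<le> K * dual_norm N w \<mu>"
      "\<And>\<mu>. \<mu> \<in> h.pushforward ` A \<Longrightarrow> dual_norm N w (T \<mu> - \<mu>) \<le> \<epsilon>"
      by blast
    have TG: "T \<mu> \<in> ?G" if "\<mu> \<in> ?G" for \<mu> using T(1) that by (auto simp: finite_rank_operator_def)
    define U where "U \<mu> = g.pushforward (T (h.pushforward \<mu>))" for \<mu>
    have "finite_rank_operator ?F U"
      unfolding finite_rank_operator_def
    proof (intro conjI ballI allI)
      show "U \<in> ?F \<rightarrow> ?F"
        using TG g.pushforward_Lipschitz_free h.pushforward_Lipschitz_free by (auto simp: U_def)
      show "U (\<mu> + \<nu>) = U \<mu> + U \<nu>" if "\<mu> \<in> ?F" "\<nu> \<in> ?F" for \<mu> \<nu>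
      proof -
        have "T (h.pushforward \<mu> + h.pushforward \<nu>) = T (h.pushforward \<mu>) + T (h.pushforward \<nu>)"
          using T(1) that h.pushforward_Lipschitz_free unfolding finite_rank_operator_def by blast
        then show ?thesis
          by (simp only: U_def linear_add[OF h.linear_pushforward] linear_add[OF g.linear_pushforward])
      qed
      show "U (c *\<^sub>R \<mu>) = c *\<^sub>R U \<mu>" if "\<mu> \<in> ?F" for c \<mu>
      proof -
        have "T (c *\<^sub>R h.pushforward \<mu>) = c *\<^sub>R T (h.pushforward \<mu>)"
          using T(1) that h.pushforward_Lipschitz_free unfolding finite_rank_operator_def by blast
        then show ?thesis
          by (simp only: U_def linear_scale[OF h.linear_pushforward] linear_scale[OF g.linear_pushforward])
      qed
      obtain B where B: "finite B" "T ` ?G \<subseteq> span B" using T(1) unfolding finite_rank_operator_def by blast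
      have "U ` ?F \<subseteq> g.pushforward ` span B"
        using B(2) h.pushforward_Lipschitz_free unfolding U_def by blast
      then show "\<exists>B. finite B \<and> U ` ?F \<subseteq> span B"
        using B(1) by (intro exI[of _ "g.pushforward ` B"])
          (simp only: linear_span_image[OF g.linear_pushforward] finite_imageI)
    qed
    moreover have "dual_norm M z (U \<mu>) \<le> K * dual_norm M z \<mu>" if \<mu>: "\<mu> \<in> ?F" for \<mu>
    proof -
      have p: "h.pushforward \<mu> \<in> ?G" by (rule h.pushforward_Lipschitz_free[OF \<mu>])
      have "dual_norm M z (U \<mu>) \<le> dual_norm N w (T (h.pushforward \<mu>))"
        unfolding U_def by (rule g.dual_norm_pushforward[OF G[OF TG[OF p]]])
      also have "\<dots> \<le> K * dual_norm N w (h.pushforward \<mu>)" by (rule T(2)[OF p])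
      also have "\<dots> \<le> K * dual_norm M z \<mu>"
        using h.dual_norm_pushforward[OF F[OF \<mu>]] bap
        by (intro mult_left_mono) (auto simp: bounded_approximation_property_def)
      finally show ?thesis .
    qed
    moreover have "dual_norm M z (U \<mu> - \<mu>) \<le> \<epsilon>" if \<mu>: "\<mu> \<in> A" for \<mu>
    proof -
      have \<mu>F: "\<mu> \<in> ?F" using \<mu> A(3) by blast
      have p: "h.pushforward \<mu> \<in> ?G" by (rule h.pushforward_Lipschitz_free[OF \<mu>F])
      have "U \<mu> - \<mu> = g.pushforward (T (h.pushforward \<mu>)) - g.pushforward (h.pushforward \<mu>)"
        unfolding U_def inv[OF F[OF \<mu>F]] ..
      also have "\<dots> = g.pushforward (T (h.pushforward \<mu>) - h.pushforward \<mu>)"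
        by (rule linear_diff[OF g.linear_pushforward, symmetric])
      finally have "dual_norm M z (U \<mu> - \<mu>) \<le> dual_norm N w (T (h.pushforward \<mu>) - h.pushforward \<mu>)"
        using g.dual_norm_pushforward[OF subspace_diff[OF subspace_Lip0_dual G[OF TG[OF p]] G[OF p]]]
        by (simp only:)
      then show ?thesis using T(3)[OF imageI[OF \<mu>]] by linarith
    qed
    ultimately show "\<exists>T. finite_rank_operator ?F T \<and> (\<forall>\<mu>\<in>?F. dual_norm M z (T \<mu>) \<le> K * dual_norm M z \<mu>) \<and>
        (\<forall>\<mu>\<in>A. dual_norm M z (T \<mu> - \<mu>) \<le> \<epsilon>)"
      by blast
  qed
qed

section \<open>Doubling spaces as sets of real numbers\<close>

text \<open>The union over \<open>n\<close> of finite \<open>1 / (n + 1)\<close>-nets of the balls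
  of radius \<open>n\<close> is countable and dense.\<close>

lemma doubling_dense_sequence:
  assumes D: "doubling_constant M D" and z: "z \<in> mspace M"
  obtains s :: "nat \<Rightarrow> 'a" where "range s \<subseteq> mspace M"
    "\<And>x e. x \<in> mspace M \<Longrightarrow> e > 0 \<Longrightarrow> \<exists>n. mdist M x (s n) < e"
proof -
  have "\<exists>N. finite N \<and> N \<subseteq> mspace M \<and> (\<forall>x\<in>mcball_of M z (real n). \<exists>y\<in>N. mdist M x y < 1 / real (Suc n))" for n
    using obtain_net[OF D z, of "1 / real (Suc n)" "real n"]
    by (metis (no_types, lifting) in_mcball_of of_nat_0_less_iff subsetD subsetI zero_less_Suc zero_less_divide_1_iff)
  then obtain N where N: "\<And>n. finite (N n) \<and> N n \<subseteq> mspace M \<and>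
      (\<forall>x\<in>mcball_of M z (real n). \<exists>y\<in>N n. mdist M x y < 1 / real (Suc n))" by metis
  define S where "S = insert z (\<Union>n. N n)"
  have S: "countable S" "S \<noteq> {}" "S \<subseteq> mspace M"
    using N z unfolding S_def by (auto intro: countable_finite)
  have dense: "\<exists>y\<in>S. mdist M x y < e" if x: "x \<in> mspace M" and e: "e > 0" for x e
  proof -
    obtain m where m: "1 / real (Suc m) < e" using nat_approx_posE[OF e] by blast
    obtain k where k: "mdist M z x \<le> real k" using real_arch_simple by blast
    define n where "n = max m k"
    have "x \<in> mcball_of M z (real n)" using x z k unfolding n_def by simp
    then obtain y where y: "y \<in> N n" "mdist M x y < 1 / real (Suc n)" using N by blast
    have "1 / real (Suc n) \<le> 1 / real (Suc m)" unfolding n_def by (intro divide_left_mono) auto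
    then show ?thesis using y m unfolding S_def by (intro bexI[of _ y]) auto
  qed
  have r: "range (from_nat_into S) = S" by (rule range_from_nat_into[OF S(2,1)])
  show ?thesis
  proof
    show "range (from_nat_into S) \<subseteq> mspace M" using r S(3) by simp
    show "\<exists>n. mdist M x (from_nat_into S n) < e" if "x \<in> mspace M" "e > 0" for x e
      using dense[OF that] r by (metis rangeE)
  qed
qed

text \<open>A point is coded by the pairs \<open>(n, k)\<close> for which it lies within
  \<open>1 / (k + 1)\<close> of \<open>s n\<close>. Distinct points get distinct codes, since an
  \<open>s n\<close> very near one of them is not near the other, and sets of naturals embed into
  the reals.\<close>

lemma doubling_inj_real:
  assumes D: "doubling_constant M D" and z: "z \<in> mspace M"
  obtains h :: "'a \<Rightarrow> real" where "inj_on h (mspace M)"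
proof -
  obtain s :: "nat \<Rightarrow> 'a" where s: "range s \<subseteq> mspace M"
      "\<And>x e. x \<in> mspace M \<Longrightarrow> e > 0 \<Longrightarrow> \<exists>n. mdist M x (s n) < e"
    using doubling_dense_sequence[OF D z] by blast
  define A where "A x = prod_encode ` {(n, k). mdist M x (s n) < 1 / real (Suc k)}" for x
  have "inj_on A (mspace M)"
  proof (rule inj_onI, rule ccontr)
    fix x y assume xy: "x \<in> mspace M" "y \<in> mspace M" "A x = A y" "x \<noteq> y"
    have "{(n, k). mdist M x (s n) < 1 / real (Suc k)} = {(n, k). mdist M y (s n) < 1 / real (Suc k)}"
      using xy(3) unfolding A_def inj_image_eq_iff[OF inj_prod_encode] .
    then have eq: "mdist M x (s n) < 1 / real (Suc k) \<longleftrightarrow> mdist M y (s n) < 1 / real (Suc k)" for n k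
      by (simp only: set_eq_iff mem_Collect_eq split_paired_All case_prod_conv)
    have "0 < mdist M x y / 2" using mdist_pos[OF xy(1,2,4)] by simp
    then obtain k where k: "1 / real (Suc k) < mdist M x y / 2" using nat_approx_posE by blast
    obtain n where n: "mdist M x (s n) < 1 / real (Suc k)" using s(2)[OF xy(1), of "1 / real (Suc k)"] by auto
    have "s n \<in> mspace M" using s(1) by auto
    from mdist_triangle[OF xy(1) this xy(2)] show False
      using n eq[of n k] k by (simp add: mdist_commute[of M y])
  qed
  moreover obtain f :: "nat set \<Rightarrow> real" where "inj f"
    using nat_sets_eqpoll_reals bij_betw_imp_inj_on unfolding eqpoll_def by metis
  ultimately have "inj_on (\<lambda>x. f (A x)) (mspace M)" by (simp add: inj_on_def)
  then show ?thesis by (rule that)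
qed

theorem corollary2p2:
  fixes M :: "'a metric" and z :: 'a and D :: real
  assumes "z \<in> mspace M" and "doubling_constant M D"
  shows "bounded_approximation_property (universal_constant * (1 + ln D))
           (Lipschitz_free M z) (dual_norm M z)"
proof -
  \<comment> \<open>The explicit constant 147 shows that the choice in
    \<open>universal_constant\<close> is not vacuous, so the chosen number has the defining
    property.\<close>
  have universal: "\<forall>(M :: real metric) z D. z \<in> mspace M \<longrightarrow> doubling_constant M D \<longrightarrow>
      bounded_approximation_property (universal_constant * (1 + ln D)) (Lipschitz_free M z) (dual_norm M z)"
    unfolding universal_constant_def
    by (rule someI[of _ 147]) (blast intro: Lipschitz_free_approximation)
  obtain h :: "'a \<Rightarrow> real" where h: "inj_on h (mspace M)"
    using doubling_inj_real[OF assms(2,1)] .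
  define g where "g = inv_into (mspace M) h"
  have gh: "\<forall>x\<in>mspace M. g (h x) = x" using h by (simp add: g_def)
  \<comment> \<open>The metric is transported along the total function \<open>g\<close>, so it is
    symmetric and nonnegative on all reals, as \<open>Metric_space\<close> demands.\<close>
  define d where "d r t = mdist M (g r) (g t)" for r t
  have "Metric_space (h ` mspace M) d"
  proof
    fix r t assume "r \<in> h ` mspace M" "t \<in> h ` mspace M"
    then show "d r t = 0 \<longleftrightarrow> r = t" using gh by (auto simp: d_def)
  next
    fix r t u assume "r \<in> h ` mspace M" "t \<in> h ` mspace M" "u \<in> h ` mspace M"
    then show "d r u \<le> d r t + d t u" using gh by (auto simp: d_def intro: mdist_triangle)
  qed (auto simp: d_def mdist_commute)
  then interpret R: Metric_space "h ` mspace M" d .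
  define N where "N = metric (h ` mspace M, d)"
  have N: "mspace N = h ` mspace M" "mdist N = d" unfolding N_def by simp_all
  have isog: "pointed_isometry N (h z) M z g"
    using assms(1) gh by unfold_locales (auto simp: N d_def)
  have isoh: "pointed_isometry M z N (h z) h"
    using assms(1) gh by unfold_locales (auto simp: N d_def)
  \<comment> \<open>The same \<open>D\<close> works for the copy: centers are mapped by
    \<open>h\<close>, which does not increase their number.\<close>
  have "doubling_constant N D"
    unfolding doubling_constant_def
  proof (intro conjI ballI allI impI)
    show "0 < D" using assms(2) by (simp add: doubling_constant_def)
    fix r and \<rho> :: real assume "r \<in> mspace N" "\<rho> > 0"
    then obtain p where p: "p \<in> mspace M" "r = h p" by (auto simp: N)
    then obtain P where P: "finite P" "P \<subseteq> mspace M" "real (card P) \<le> D"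
        "mball_of M p \<rho> \<subseteq> (\<Union>q\<in>P. mball_of M q (\<rho> / 2))"
      using assms(2) \<open>\<rho> > 0\<close> unfolding doubling_constant_def by blast
    have "mball_of N r \<rho> \<subseteq> (\<Union>q\<in>h ` P. mball_of N q (\<rho> / 2))"
    proof
      fix t assume "t \<in> mball_of N r \<rho>"
      then obtain x where x: "t = h x" "x \<in> mball_of M p \<rho>" using p gh by (auto simp: N d_def)
      then obtain q where "q \<in> P" "x \<in> mball_of M q (\<rho> / 2)" using P(4) by blast
      then show "t \<in> (\<Union>q\<in>h ` P. mball_of N q (\<rho> / 2))" using x gh by (auto simp: N d_def)
    qed
    moreover have "real (card (h ` P)) \<le> D" using card_image_le[OF P(1), of h] P(3) by linarith
    ultimately show "\<exists>P. finite P \<and> P \<subseteq> mspace N \<and> real (card P) \<le> D \<and>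
        mball_of N r \<rho> \<subseteq> (\<Union>q\<in>P. mball_of N q (\<rho> / 2))"
      using P(1,2) by (intro exI[of _ "h ` P"]) (auto simp: N)
  qed
  moreover have "h z \<in> mspace N" using assms(1) by (simp add: N)
  ultimately have "bounded_approximation_property (universal_constant * (1 + ln D))
      (Lipschitz_free N (h z)) (dual_norm N (h z))"
    using universal by blast
  then show ?thesis by (rule bounded_approximation_property_isometry[OF isog isoh gh])
qed

end
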